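(* For $d\ge2$ even, for $D$ sufficiently large in terms of $d$, and for $N\ge D^d$, there exists an $N$-vertex semialgebraic graph in $\mathbb{R}^d$ with total degree $D$ that does not contain a clique or independent set of size at least $$N^{\left(4+o(1)\right)\frac{\log\log D}{d\log D}},$$ where the $o(1)$ term goes to zero for each fixed $d$ as $D$ goes to infinity.
   Context: A bipartite semialgebraic graph in $\mathbb{R}^d$ is $G'=(P_1\sqcup P_2,E')$ with $P_1,P_2\subset\mathbb{R}^d$ finite (regarded as disjoint vertex classes), $E'\subseteq P_1\times P_2$, for which there are polynomials $g_1,\dots,g_t\in\mathbb{R}[x_{11},\dots,x_{1d},x_{21},\dots,x_{2d}]$ and $\Phi:\{-1,0,1\}^t\to\{0,1\}$ such that $(x_1,x_2)\in P_1\times P_2$ is an edge if and only if $\Phi(\operatorname{sgn}(g_1(x_1,x_2)),\dots,\operatorname{sgn}(g_t(x_1,x_2)))=1$. Its total degree is $\sum_r\deg g_r$. It is symmetric if for all $(x_1,x_2)\in\mathbb{R}^{2d}$ the value of $\Phi(\operatorname{sgn}(g_1),\dots,\operatorname{sgn}(g_t))$ is the same at $(x_1,x_2)$ and at $(x_2,x_1)$. A (non-partite) graph $G=(V,E)$ with $V\subset\mathbb{R}^d$ finite is a semialgebraic graph in $\mathbb{R}^d$ with total degree $D$ if there is a symmetric bipartite semialgebraic graph $G'=(V\sqcup V,E')$ of total degree $D$ such that, for distinct $v_1,v_2\in V$, $\{v_1,v_2\}$ is an edge of $G$ if and only if $(v_1,v_2)$ is an edge of $G'$. *)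

theory Defs
  imports
    "HOL-Analysis.Analysis"
    "HOL-Library.Poly_Mapping"
    "HOL-Library.Ramsey"
begin

section \<open>Real multivariate polynomials\<close>

text \<open>
  A polynomial maps each monomial (a finitely supported exponent function on the variables) to
  its coefficient; only finitely many coefficients are nonzero. The ring operations are those of
  \<^theory>\<open>HOL-Library.Poly_Mapping\<close>.
\<close>

type_synonym 'v real_mpoly = "('v \<Rightarrow>\<^sub>0 nat) \<Rightarrow>\<^sub>0 real"

definition mpoly_value :: "'v real_mpoly \<Rightarrow> ('v \<Rightarrow> real) \<Rightarrow> real" where
  "mpoly_value p a =
     (\<Sum>m \<in> Poly_Mapping.keys p. Poly_Mapping.lookup p m *
        (\<Prod>v \<in> Poly_Mapping.keys m. a v ^ Poly_Mapping.lookup m v))"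

text \<open>Total degree; the zero polynomial has degree 0.\<close>

definition mpoly_degree :: "'v real_mpoly \<Rightarrow> nat" where
  "mpoly_degree p =
     Max (insert 0 ((\<lambda>m. \<Sum>v \<in> Poly_Mapping.keys m. Poly_Mapping.lookup m v)
                      ` Poly_Mapping.keys p))"

section \<open>Semialgebraic graphs\<close>

text \<open>
  The points of $\mathbb{R}^d$ are \<^typ>\<open>real ^ 'n\<close>, where \<open>d = CARD('n)\<close>. In a polynomial in
  $x_{11},\dots,x_{1d},x_{21},\dots,x_{2d}$, the variable $x_{1i}$ is \<open>Inl i\<close> and $x_{2i}$ is
  \<open>Inr i\<close>.
\<close>

definition eval_pair :: "('n::finite + 'n) real_mpoly \<Rightarrow> real ^ 'n \<Rightarrow> real ^ 'n \<Rightarrow> real" where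
  "eval_pair g x y = mpoly_value g (case_sum (\<lambda>i. x $ i) (\<lambda>i. y $ i))"

text \<open>
  A description consists of the list $g_1,\dots,g_t$ and a Boolean function \<open>\<Phi>\<close>, which is only
  ever applied to lists of length $t$ with entries in $\{-1,0,1\}$.
\<close>

definition sign_condition ::
  "('n::finite + 'n) real_mpoly list \<Rightarrow> (real list \<Rightarrow> bool) \<Rightarrow> real ^ 'n \<Rightarrow> real ^ 'n \<Rightarrow> bool" where
  "sign_condition gs \<Phi> x y \<longleftrightarrow> \<Phi> (map (\<lambda>g. sgn (eval_pair g x y)) gs)"

text \<open>
  The vertex classes are regarded as disjoint copies of \<open>P1\<close> and \<open>P2\<close>, which may overlap as sets;
  accordingly the edges are ordered pairs.
\<close>

definition bipartite_semialgebraic ::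
  "(real ^ 'n::finite) set \<Rightarrow> (real ^ 'n) set \<Rightarrow> ((real ^ 'n) \<times> (real ^ 'n)) set \<Rightarrow>
   ('n + 'n) real_mpoly list \<Rightarrow> (real list \<Rightarrow> bool) \<Rightarrow> bool" where
  "bipartite_semialgebraic P1 P2 E' gs \<Phi> \<longleftrightarrow>
     finite P1 \<and> finite P2 \<and> E' \<subseteq> P1 \<times> P2 \<and>
     (\<forall>x\<in>P1. \<forall>y\<in>P2. (x, y) \<in> E' \<longleftrightarrow> sign_condition gs \<Phi> x y)"

definition total_degree :: "'v real_mpoly list \<Rightarrow> nat" where
  "total_degree gs = (\<Sum>g\<leftarrow>gs. mpoly_degree g)"

text \<open>Symmetry is required on all of $\mathbb{R}^{2d}$, not only on the vertices.\<close>

definition symmetric_description ::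
  "('n::finite + 'n) real_mpoly list \<Rightarrow> (real list \<Rightarrow> bool) \<Rightarrow> bool" where
  "symmetric_description gs \<Phi> \<longleftrightarrow>
     (\<forall>x y. sign_condition gs \<Phi> x y \<longleftrightarrow> sign_condition gs \<Phi> y x)"

definition semialgebraic_graph ::
  "(real ^ 'n::finite) set \<Rightarrow> (real ^ 'n) set set \<Rightarrow> nat \<Rightarrow> bool" where
  "semialgebraic_graph V E D \<longleftrightarrow>
     finite V \<and> E \<subseteq> [V]\<^bsup>2\<^esup> \<and>
     (\<exists>E' gs \<Phi>. bipartite_semialgebraic V V E' gs \<Phi> \<and>
        symmetric_description gs \<Phi> \<and> total_degree gs = D \<and>
        (\<forall>v1\<in>V. \<forall>v2\<in>V. v1 \<noteq> v2 \<longrightarrow> ({v1, v2} \<in> E \<longleftrightarrow> (v1, v2) \<in> E')))"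

end

theory Submission
  imports Defs "HOL-Real_Asymp.Real_Asymp"
begin

text \<open>
  Write \<open>d = 2 e\<close> and put the vectors of $\{0,\dots,m-1\}^e$, where $m \approx D / d$, on a product of
  \<open>e\<close> parabolas. Comparing the slopes of the chords with half-integer thresholds takes \<open>D\<close> linear
  forms in the difference of two points, whose signs determine, up to a common sign, for each
  entry whether the two vectors agree there and, if not, the sum of their entries. So the pattern of
  signs properly colours the pairs of the $m^e$ points. Among \<open>k\<close> points, one at a time, either the
  next point brings many new colours or it lies in a set of size polynomial in \<open>k\<close>. Hence by a
  first moment estimate a random 2-colouring of the colours has, on a random sparse subset of
  about $D^{3d/8}$ points, no homogeneous set of size \<open>O(log D)\<close>: sparsity kills the points
  of the second kind.

  Since only signs of linear forms matter, iterating with rapidly decreasing scales gives all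
  lexicographic powers of this graph with the same \<open>D\<close> forms. With \<open>y = ln N / (d ln D) \<ge> 1\<close>, the
  number of levels needed is at most $\lceil 8y/3 \rceil \le 11y/3 < 4y$, so rounding up is harmless and
  even \<open>\<epsilon> = 0\<close> works.
\<close>

section \<open>Linear polynomials of differences\<close>

definition linear_mpoly :: "('v::finite \<Rightarrow> real) \<Rightarrow> 'v real_mpoly" where
  "linear_mpoly c = (\<Sum>v\<in>UNIV. Poly_Mapping.single (Poly_Mapping.single v 1) (c v))"

lemma single_Suc_0_eq_iff:
  "Poly_Mapping.single v (Suc 0) = Poly_Mapping.single w (Suc 0) \<longleftrightarrow> v = w"
proof
  assume "Poly_Mapping.single v (Suc 0) = Poly_Mapping.single w (Suc 0)"
  then have "Poly_Mapping.keys (Poly_Mapping.single v (Suc 0)) =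
      Poly_Mapping.keys (Poly_Mapping.single w (Suc 0))" by (rule arg_cong)
  then show "v = w" by simp
qed simp

lemma lookup_linear_mpoly:
  "Poly_Mapping.lookup (linear_mpoly c) (Poly_Mapping.single v (Suc 0)) = c v"
  unfolding linear_mpoly_def
  by (simp add: lookup_sum lookup_single single_Suc_0_eq_iff when_def sum.delta)

lemma keys_linear_mpoly:
  "Poly_Mapping.keys (linear_mpoly c) = (\<lambda>v. Poly_Mapping.single v 1) ` {v. c v \<noteq> 0}"
proof (intro equalityI subsetI)
  fix m assume "m \<in> Poly_Mapping.keys (linear_mpoly c)"
  then have "m \<in> (\<Union>v. Poly_Mapping.keys (Poly_Mapping.single (Poly_Mapping.single v (1::nat)) (c v)))"
    unfolding linear_mpoly_def by (rule subsetD[OF keys_sum])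
  then show "m \<in> (\<lambda>v. Poly_Mapping.single v 1) ` {v. c v \<noteq> 0}"
    by (auto split: if_splits)
next
  fix m assume "m \<in> (\<lambda>v. Poly_Mapping.single v (1::nat)) ` {v. c v \<noteq> 0}"
  then show "m \<in> Poly_Mapping.keys (linear_mpoly c)"
    by (auto simp: in_keys_iff lookup_linear_mpoly)
qed

lemma mpoly_value_linear_mpoly: "mpoly_value (linear_mpoly c) a = (\<Sum>v\<in>UNIV. c v * a v)"
proof -
  have "mpoly_value (linear_mpoly c) a = (\<Sum>v | c v \<noteq> 0. c v * a v)"
    unfolding mpoly_value_def keys_linear_mpoly
    by (subst sum.reindex) (auto simp: inj_on_def single_Suc_0_eq_iff lookup_linear_mpoly)
  also have "\<dots> = (\<Sum>v\<in>UNIV. c v * a v)"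
    by (rule sum.mono_neutral_left) auto
  finally show ?thesis .
qed

lemma mpoly_degree_linear_mpoly:
  assumes "c v \<noteq> 0"
  shows "mpoly_degree (linear_mpoly c) = 1"
proof -
  have "(\<lambda>m. \<Sum>v \<in> Poly_Mapping.keys m. Poly_Mapping.lookup m v) ` Poly_Mapping.keys (linear_mpoly c)
      = {1::nat}"
    unfolding keys_linear_mpoly image_image using assms by auto
  then show ?thesis
    unfolding mpoly_degree_def by simp
qed

definition difference_mpoly :: "real ^ 'n \<Rightarrow> ('n::finite + 'n) real_mpoly" where
  "difference_mpoly a = linear_mpoly (case_sum (\<lambda>i. a $ i) (\<lambda>i. - a $ i))"

lemma sum_UNIV_sum_type:
  "(\<Sum>v\<in>UNIV. f v) = (\<Sum>i\<in>UNIV. f (Inl i)) + (\<Sum>i\<in>UNIV. f (Inr i))"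
  for f :: "'a::finite + 'b::finite \<Rightarrow> 'c::comm_monoid_add"
  using sum.Plus[of "UNIV :: 'a set" "UNIV :: 'b set" f] by (simp add: comp_def)

lemma eval_pair_difference_mpoly: "eval_pair (difference_mpoly a) x y = a \<bullet> (x - y)"
proof -
  have "eval_pair (difference_mpoly a) x y =
      (\<Sum>i\<in>UNIV. a $ i * x $ i) + (\<Sum>i\<in>UNIV. - a $ i * y $ i)"
    unfolding eval_pair_def difference_mpoly_def mpoly_value_linear_mpoly
    by (simp only: sum_UNIV_sum_type sum.case)
  also have "\<dots> = a \<bullet> (x - y)"
    by (simp add: inner_vec_def right_diff_distrib sum_subtractf sum_negf)
  finally show ?thesis .
qed

text \<open>The total degree has to equal \<open>D\<close>, not merely be bounded by it. The two
  points use disjoint variables, so a nonzero entry of \<open>a\<close> survives as a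
  coefficient.\<close>

lemma mpoly_degree_difference_mpoly:
  assumes "a \<noteq> 0"
  shows "mpoly_degree (difference_mpoly a) = 1"
proof -
  obtain i where "a $ i \<noteq> 0"
    using assms by (auto simp: vec_eq_iff)
  then show ?thesis
    unfolding difference_mpoly_def by (intro mpoly_degree_linear_mpoly[of _ "Inl i"]) simp
qed

section \<open>Lexicographic powers of sign conditions\<close>

definition sign_vector :: "nat \<Rightarrow> (nat \<Rightarrow> 'v::real_inner) \<Rightarrow> 'v \<Rightarrow> real list" where
  "sign_vector D a x = map (\<lambda>r. sgn (a r \<bullet> x)) [0..<D]"

lemma sign_vector_eq_iff:
  "sign_vector D a x = sign_vector D a y \<longleftrightarrow> (\<forall>r<D. sgn (a r \<bullet> x) = sgn (a r \<bullet> y))"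
  unfolding sign_vector_def by auto

lemma sign_vector_minus: "sign_vector D a (- x) = map uminus (sign_vector D a x)"
  unfolding sign_vector_def by (simp add: sgn_minus)

lemma sign_vector_scaleR: "t > 0 \<Longrightarrow> sign_vector D a (t *\<^sub>R x) = sign_vector D a x"
  unfolding sign_vector_def by (simp add: sgn_mult)

text \<open>General position with respect to the forms: the signs are strict, hence stable under
  small perturbations.\<close>

definition separated :: "nat \<Rightarrow> (nat \<Rightarrow> 'v::real_inner) \<Rightarrow> 'v set \<Rightarrow> bool" where
  "separated D a V \<longleftrightarrow> (\<forall>x\<in>V. \<forall>y\<in>V. x \<noteq> y \<longrightarrow> (\<forall>r<D. a r \<bullet> (x - y) \<noteq> 0))"

lemma separated_subset: "separated D a V \<Longrightarrow> U \<subseteq> V \<Longrightarrow> separated D a U"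
  unfolding separated_def by blast

text \<open>Covers cliques and independent sets at once; for at most one vertex both alternatives
  hold.\<close>

definition homogeneous :: "('a \<Rightarrow> 'a \<Rightarrow> bool) \<Rightarrow> 'a set \<Rightarrow> bool" where
  "homogeneous R S \<longleftrightarrow>
    (\<forall>x\<in>S. \<forall>y\<in>S. x \<noteq> y \<longrightarrow> R x y) \<or> (\<forall>x\<in>S. \<forall>y\<in>S. x \<noteq> y \<longrightarrow> \<not> R x y)"

lemma homogeneousI:
  assumes "\<And>x y. x \<in> S \<Longrightarrow> y \<in> S \<Longrightarrow> x \<noteq> y \<Longrightarrow> R x y = b"
  shows "homogeneous R S"
  using assms by (cases b) (simp_all add: homogeneous_def)

lemma homogeneousE:
  assumes "homogeneous R S"
  obtains b where "\<And>x y. x \<in> S \<Longrightarrow> y \<in> S \<Longrightarrow> x \<noteq> y \<Longrightarrow> R x y = b"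
  using assms unfolding homogeneous_def
proof
  assume "\<forall>x\<in>S. \<forall>y\<in>S. x \<noteq> y \<longrightarrow> R x y"
  then show thesis by (intro that[of True]) simp
next
  assume "\<forall>x\<in>S. \<forall>y\<in>S. x \<noteq> y \<longrightarrow> \<not> R x y"
  then show thesis by (intro that[of False]) simp
qed

lemma homogeneous_subset: "homogeneous R S \<Longrightarrow> T \<subseteq> S \<Longrightarrow> homogeneous R T"
  unfolding homogeneous_def by blast

section \<open>Stability of signs under small perturbations\<close>

lemma eventually_sgn_add_mult:
  fixes s t :: real
  assumes "s \<noteq> 0"
  shows "\<forall>\<^sub>F \<eta> in at_right 0. sgn (s + \<eta> * t) = sgn s"
proof -
  have lim: "((\<lambda>\<eta>. s + \<eta> * t) \<longlongrightarrow> s) (at_right 0)"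
    by (auto intro!: tendsto_eq_intros)
  show ?thesis
  proof (cases "s > 0")
    case True
    then show ?thesis
      using order_tendstoD(1)[OF lim, of 0] by (auto elim!: eventually_mono)
  next
    case False
    then have "s < 0" using assms by simp
    then show ?thesis
      using order_tendstoD(2)[OF lim, of 0] by (auto elim!: eventually_mono)
  qed
qed

text \<open>Each relevant sign is nonzero by separation and so persists for all sufficiently small
  positive scales; finitely many such conditions hold together.\<close>

lemma exists_small_scale:
  fixes X V :: "'v::real_inner set"
  assumes "finite X" "finite V" "separated D a X"
  obtains \<eta> where "\<eta> > 0"
    "\<And>u u' v v'. u \<in> X \<Longrightarrow> u' \<in> X \<Longrightarrow> u \<noteq> u' \<Longrightarrow> v \<in> V \<Longrightarrow> v' \<in> V \<Longrightarrow>
      sign_vector D a ((u + \<eta> *\<^sub>R v) - (u' + \<eta> *\<^sub>R v')) = sign_vector D a (u - u')"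
proof -
  have "\<forall>\<^sub>F \<eta> in at_right 0. \<forall>u\<in>X. \<forall>u'\<in>X. \<forall>v\<in>V. \<forall>v'\<in>V. \<forall>r\<in>{..<D}.
      u \<noteq> u' \<longrightarrow> sgn (a r \<bullet> (u - u') + \<eta> * (a r \<bullet> (v - v'))) = sgn (a r \<bullet> (u - u'))"
  proof (intro eventually_ball_finite ballI assms(1,2) finite_lessThan)
    fix u u' v v' r assume *: "u \<in> X" "u' \<in> X" "r \<in> {..<D}"
    show "\<forall>\<^sub>F \<eta> in at_right 0. u \<noteq> u' \<longrightarrow>
        sgn (a r \<bullet> (u - u') + \<eta> * (a r \<bullet> (v - v'))) = sgn (a r \<bullet> (u - u'))"
    proof (cases "u = u'")
      case False
      then have "a r \<bullet> (u - u') \<noteq> 0"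
        using * assms(3) unfolding separated_def by auto
      then show ?thesis
        by (rule eventually_mono[OF eventually_sgn_add_mult[of _ "a r \<bullet> (v - v')"]]) simp
    qed simp
  qed
  then have "\<forall>\<^sub>F \<eta> in at_right 0. \<eta> > 0 \<and> (\<forall>u\<in>X. \<forall>u'\<in>X. \<forall>v\<in>V. \<forall>v'\<in>V. \<forall>r\<in>{..<D}.
      u \<noteq> u' \<longrightarrow> sgn (a r \<bullet> (u - u') + \<eta> * (a r \<bullet> (v - v'))) = sgn (a r \<bullet> (u - u')))"
    by (intro eventually_conj eventually_at_right_less)
  then have "\<exists>\<eta>>0. \<forall>u\<in>X. \<forall>u'\<in>X. \<forall>v\<in>V. \<forall>v'\<in>V. \<forall>r\<in>{..<D}.
      u \<noteq> u' \<longrightarrow> sgn (a r \<bullet> (u - u') + \<eta> * (a r \<bullet> (v - v'))) = sgn (a r \<bullet> (u - u'))"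
    by (rule eventually_happens'[rotated]) simp
  then obtain \<eta> :: real where \<eta>: "\<eta> > 0" "\<forall>u\<in>X. \<forall>u'\<in>X. \<forall>v\<in>V. \<forall>v'\<in>V. \<forall>r\<in>{..<D}.
      u \<noteq> u' \<longrightarrow> sgn (a r \<bullet> (u - u') + \<eta> * (a r \<bullet> (v - v'))) = sgn (a r \<bullet> (u - u'))"
    by (elim exE conjE)
  show thesis
  proof (rule that[OF \<eta>(1)])
    fix u u' v v' assume *: "u \<in> X" "u' \<in> X" "u \<noteq> u'" "v \<in> V" "v' \<in> V"
    have eq: "(u + \<eta> *\<^sub>R v) - (u' + \<eta> *\<^sub>R v') = (u - u') + \<eta> *\<^sub>R (v - v')"
      by (simp add: algebra_simps)
    show "sign_vector D a ((u + \<eta> *\<^sub>R v) - (u' + \<eta> *\<^sub>R v')) = sign_vector D a (u - u')"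
      unfolding eq sign_vector_eq_iff inner_add_right inner_scaleR_right
      using \<eta>(2) * by blast
  qed
qed

text \<open>
  The induction step substitutes a tiny copy of the current configuration for every point of
  \<open>X\<close>, which realises the lexicographic product of the two graphs.
\<close>

lemma exists_lexicographic_power:
  fixes X :: "'v::real_inner set" and a :: "nat \<Rightarrow> 'v" and D n :: nat
    and \<Psi> :: "real list \<Rightarrow> bool"
  defines "R \<equiv> \<lambda>x y. \<Psi> (sign_vector D a (x - y))"
  assumes "finite X" "separated D a X" "D > 0"
    and bound: "\<And>S. S \<subseteq> X \<Longrightarrow> homogeneous R S \<Longrightarrow> card S \<le> K"
  shows "\<exists>V. finite V \<and> separated D a V \<and> card V = card X ^ n \<and>
    (\<forall>S\<subseteq>V. homogeneous R S \<longrightarrow> card S \<le> K ^ n)"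
proof (induction n)
  case 0
  \<comment> \<open>The empty power is a single point, which matches
    \<open>K ^ 0 = 1\<close>.\<close>
  have "card S \<le> 1" if "S \<subseteq> {0::'v}" for S
    using that by (metis card.empty card.insert card_mono empty_iff finite.emptyI finite.insertI One_nat_def)
  then show ?case
    by (intro exI[of _ "{0}"]) (auto simp: separated_def)
next
  case (Suc n)
  then obtain V where V: "finite V" "separated D a V" "card V = card X ^ n"
    and V_bound: "\<And>S. S \<subseteq> V \<Longrightarrow> homogeneous R S \<Longrightarrow> card S \<le> K ^ n"
    by blast
  obtain \<eta> where \<eta>: "\<eta> > 0"
    and dominated: "\<And>u u' v v'. u \<in> X \<Longrightarrow> u' \<in> X \<Longrightarrow> u \<noteq> u' \<Longrightarrow> v \<in> V \<Longrightarrow> v' \<in> V \<Longrightarrow>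
      sign_vector D a ((u + \<eta> *\<^sub>R v) - (u' + \<eta> *\<^sub>R v')) = sign_vector D a (u - u')"
    using exists_small_scale[OF \<open>finite X\<close> V(1) \<open>separated D a X\<close>] by metis
  define h where "h = (\<lambda>(u, v). u + \<eta> *\<^sub>R v :: 'v)"
  \<comment> \<open>Between different copies the large scale decides the signs. Inside one copy the
    difference is \<open>\<eta>\<close> times a difference in \<open>V\<close>, and positive scaling
    changes no sign.\<close>
  have outer: "sign_vector D a (h (u, v) - h (u', v')) = sign_vector D a (u - u')"
    if "u \<in> X" "u' \<in> X" "u \<noteq> u'" "v \<in> V" "v' \<in> V" for u u' v v'
    using dominated[OF that] by (simp add: h_def)
  have inner: "sign_vector D a (h (u, v) - h (u, v')) = sign_vector D a (v - v')" for u v v'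
    using sign_vector_scaleR[OF \<eta>, of D a "v - v'"] by (simp add: h_def algebra_simps)
  have sep: "\<forall>r<D. a r \<bullet> (h x - h y) \<noteq> 0" if xy: "x \<in> X \<times> V" "y \<in> X \<times> V" "x \<noteq> y" for x y
  proof -
    obtain u v u' v' where eq: "x = (u, v)" "y = (u', v')" by fastforce
    have "\<exists>w. (\<forall>r<D. a r \<bullet> w \<noteq> 0) \<and> sign_vector D a (h x - h y) = sign_vector D a w"
    proof (cases "u = u'")
      case True
      then show ?thesis
        using xy V(2) inner unfolding eq separated_def by (intro exI[of _ "v - v'"]) auto
    next
      case False
      then show ?thesis
        using xy \<open>separated D a X\<close> outer unfolding eq separated_def
        by (intro exI[of _ "u - u'"]) auto
    qed
    then show ?thesis
      unfolding sign_vector_eq_iff by (metis sgn_0_0)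
  qed
  \<comment> \<open>If two images coincided, every form would vanish on their difference;
    \<open>D > 0\<close> provides a form to contradict \<open>sep\<close>.\<close>
  have inj: "inj_on h (X \<times> V)"
  proof (rule inj_onI, rule ccontr)
    fix x y assume "x \<in> X \<times> V" "y \<in> X \<times> V" "h x = h y" "x \<noteq> y"
    then show False using sep[of x y] \<open>D > 0\<close> by auto
  qed
  have "separated D a (h ` (X \<times> V))"
    unfolding separated_def using sep by (metis (no_types, lifting) imageE)
  moreover have "card (h ` (X \<times> V)) = card X ^ Suc n"
    using inj V(3) by (simp add: card_image card_cartesian_product)
  moreover have "card S \<le> K ^ Suc n" if S: "S \<subseteq> h ` (X \<times> V)" "homogeneous R S" for S
  proof -
    obtain T where T: "T \<subseteq> X \<times> V" "S = h ` T"
      using S(1) by (meson subset_image_iff)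
    have fT: "finite T"
      using T(1) V(1) \<open>finite X\<close> finite_subset by (metis finite_cartesian_product)
    obtain b where b: "\<And>x y. x \<in> T \<Longrightarrow> y \<in> T \<Longrightarrow> x \<noteq> y \<Longrightarrow> R (h x) (h y) = b"
    proof -
      from S(2) obtain b where b: "\<And>x y. x \<in> S \<Longrightarrow> y \<in> S \<Longrightarrow> x \<noteq> y \<Longrightarrow> R x y = b"
        by (rule homogeneousE) blast
      show thesis
      proof (rule that[of b])
        fix x y assume xy: "x \<in> T" "y \<in> T" "x \<noteq> y"
        then have "h x \<noteq> h y" using inj T(1) by (meson inj_onD subsetD)
        then show "R (h x) (h y) = b" using b xy T(2) by simp
      qed
    qed
    \<comment> \<open>Points in different copies see only the outer graph, so the projection to
      \<open>X\<close> is homogeneous; likewise each fibre is homogeneous in the inner graph. This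
      leaves at most \<open>K\<close> fibres of size at most \<open>K ^ n\<close>.\<close>
    have "R u u' = b" if uu': "u \<in> fst ` T" "u' \<in> fst ` T" "u \<noteq> u'" for u u'
    proof -
      obtain v v' where vv': "(u, v) \<in> T" "(u', v') \<in> T" using uu' by auto
      then have "u \<in> X" "u' \<in> X" "v \<in> V" "v' \<in> V" using T(1) by auto
      then show ?thesis
        using b[OF vv'] outer[of u u' v v'] uu'(3) by (simp add: R_def)
    qed
    then have "homogeneous R (fst ` T)"
      by (rule homogeneousI)
    then have fst_le: "card (fst ` T) \<le> K"
      using T(1) by (intro bound) auto
    have fibre_le: "card {v. (u, v) \<in> T} \<le> K ^ n" for u
    proof (rule V_bound)
      have "R v v' = b" if "(u, v) \<in> T" "(u, v') \<in> T" "v \<noteq> v'" for v v'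
        using b[OF that(1,2)] inner[of u v v'] that(3) by (simp add: R_def)
      then show "homogeneous R {v. (u, v) \<in> T}"
        by (intro homogeneousI[of _ _ b]) simp
    qed (use T(1) in auto)
    have "finite {v. (u, v) \<in> T}" for u
      using T(1) V(1) by (rule_tac finite_subset[of _ V]) auto
    then have "card (SIGMA u:fst ` T. {v. (u, v) \<in> T}) = (\<Sum>u\<in>fst ` T. card {v. (u, v) \<in> T})"
      using fT by (intro card_SigmaI) auto
    moreover have "(SIGMA u:fst ` T. {v. (u, v) \<in> T}) = T"
      by (auto intro: rev_image_eqI)
    ultimately have "card T = (\<Sum>u\<in>fst ` T. card {v. (u, v) \<in> T})"
      by simp
    also have "\<dots> \<le> card (fst ` T) * K ^ n"
      using sum_bounded_above[of "fst ` T" "\<lambda>u. card {v. (u, v) \<in> T}" "K ^ n"] fibre_le by simp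
    also have "\<dots> \<le> K * K ^ n"
      using fst_le by (rule mult_le_mono1)
    finally show ?thesis
      unfolding T(2) using card_image_le[OF fT, of h] by simp
  qed
  ultimately show ?case
    using V(1) \<open>finite X\<close> by (intro exI[of _ "h ` (X \<times> V)"]) auto
qed

text \<open>Invariance of \<open>\<Psi>\<close> under negation makes the condition symmetric on all
  pairs of points of the space, as a symmetric description requires. The \<open>D\<close> nonzero
  forms, each of degree 1, give total degree exactly \<open>D\<close>.\<close>

lemma exists_graph_of_sign_vectors:
  fixes V :: "(real ^ 'n::finite) set" and a :: "nat \<Rightarrow> real ^ 'n" and D :: nat
    and \<Psi> :: "real list \<Rightarrow> bool"
  defines "R \<equiv> \<lambda>x y. \<Psi> (sign_vector D a (x - y))"
  assumes "finite V" "\<And>r. r < D \<Longrightarrow> a r \<noteq> 0"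
    and symmetric: "\<And>\<sigma>. \<Psi> (map uminus \<sigma>) = \<Psi> \<sigma>"
  obtains E where "semialgebraic_graph V E D"
    "\<forall>S\<subseteq>V. clique S E \<or> indep S E \<longrightarrow> homogeneous R S"
proof -
  let ?gs = "map (\<lambda>r. difference_mpoly (a r)) [0..<D]"
  let ?E = "{{x, y} | x y. x \<in> V \<and> y \<in> V \<and> x \<noteq> y \<and> R x y}"
  have R_sym: "R x y = R y x" for x y
    unfolding R_def using symmetric sign_vector_minus[of D a "x - y"] by (metis minus_diff_eq)
  have sign: "sign_condition ?gs \<Psi> x y \<longleftrightarrow> R x y" for x y
    unfolding sign_condition_def R_def sign_vector_def
    by (simp add: eval_pair_difference_mpoly comp_def)
  have edge: "{x, y} \<in> ?E \<longleftrightarrow> R x y" if "x \<in> V" "y \<in> V" "x \<noteq> y" for x y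
    using that R_sym by (auto simp: doubleton_eq_iff)
  have "total_degree ?gs = D"
    unfolding total_degree_def using assms(3)
    by (simp add: comp_def mpoly_degree_difference_mpoly sum_list_sum_nth)
  moreover have "symmetric_description ?gs \<Psi>"
    unfolding symmetric_description_def sign using R_sym by blast
  moreover have "bipartite_semialgebraic V V {(x, y) \<in> V \<times> V. R x y} ?gs \<Psi>"
    unfolding bipartite_semialgebraic_def sign using assms(2) by auto
  moreover have "?E \<subseteq> [V]\<^bsup>2\<^esup>" by auto
  ultimately have graph: "semialgebraic_graph V ?E D"
    unfolding semialgebraic_graph_def using assms(2) edge
    by (intro conjI exI[of _ "{(x, y) \<in> V \<times> V. R x y}"] exI[of _ ?gs] exI[of _ \<Psi>]) auto
  show thesis
  proof (rule that[OF graph], intro allI impI)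
    fix S assume S: "S \<subseteq> V" "clique S ?E \<or> indep S ?E"
    from S(2) show "homogeneous R S"
    proof
      assume "clique S ?E"
      then show ?thesis
        unfolding clique_def using edge S(1) by (intro homogeneousI[of _ _ True]) (meson subsetD)
    next
      assume "indep S ?E"
      then show ?thesis
        unfolding indep_def using edge S(1) by (intro homogeneousI[of _ _ False]) (meson subsetD)
    qed
  qed
qed

section \<open>Random colourings of a properly coloured complete graph\<close>

definition pair_colours :: "('a \<Rightarrow> 'a \<Rightarrow> 'c) \<Rightarrow> 'a set \<Rightarrow> 'c set" where
  "pair_colours c S = {c x y | x y. x \<in> S \<and> y \<in> S \<and> x \<noteq> y}"

lemma pair_colours_eq_image: "pair_colours c S = (\<lambda>(x, y). c x y) ` (S \<times> S - Id)"
  unfolding pair_colours_def by auto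

lemma finite_pair_colours: "finite S \<Longrightarrow> finite (pair_colours c S)"
  unfolding pair_colours_eq_image by simp

lemma pair_colours_mono: "S \<subseteq> T \<Longrightarrow> pair_colours c S \<subseteq> pair_colours c T"
  unfolding pair_colours_def by blast

lemma card_pair_colours_le:
  assumes "finite S"
  shows "card (pair_colours c S) \<le> card S * card S"
proof -
  have "card (pair_colours c S) \<le> card (S \<times> S - Id)"
    unfolding pair_colours_eq_image using assms by (intro card_image_le) simp
  also have "\<dots> \<le> card (S \<times> S)"
    using assms by (intro card_mono) auto
  finally show ?thesis
    by (simp add: card_cartesian_product)
qed

text \<open>Ordered enumerations of the \<open>k\<close>-subsets let vertices be added one at a
  time. Each set is counted \<open>k!\<close> times, which the first moment estimate can
  afford.\<close>

definition injective_lists :: "'a set \<Rightarrow> nat \<Rightarrow> 'a list set" where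
  "injective_lists W k = {ts. length ts = k \<and> distinct ts \<and> set ts \<subseteq> W}"

lemma finite_injective_lists: "finite W \<Longrightarrow> finite (injective_lists W k)"
  unfolding injective_lists_def
  by (rule finite_subset[OF _ finite_lists_length_eq[of W k]]) auto

lemma injective_lists_0: "injective_lists W 0 = {[]}"
  unfolding injective_lists_def by auto

lemma injective_lists_Suc:
  "injective_lists W (Suc k) = (\<lambda>(ts, v). v # ts) ` (SIGMA ts:injective_lists W k. W - set ts)"
  unfolding injective_lists_def by (auto simp: length_Suc_conv image_iff)

lemma sum_injective_lists_Suc:
  assumes "finite W"
  shows "sum f (injective_lists W (Suc k)) =
    (\<Sum>ts\<in>injective_lists W k. \<Sum>v\<in>W - set ts. f (v # ts))"
proof -
  have "inj_on (\<lambda>(ts, v). v # ts) (SIGMA ts:injective_lists W k. W - set ts)"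
    by (auto simp: inj_on_def)
  then have "sum f (injective_lists W (Suc k)) =
      (\<Sum>(ts, v)\<in>(SIGMA ts:injective_lists W k. W - set ts). f (v # ts))"
    unfolding injective_lists_Suc by (subst sum.reindex) (auto simp: case_prod_unfold)
  then show ?thesis
    using assms by (subst sum.Sigma) (auto simp: finite_injective_lists)
qed

text \<open>A proper edge colouring of the complete graph on \<open>W\<close>.\<close>

locale proper_pair_colouring =
  fixes W :: "'a set" and c :: "'a \<Rightarrow> 'a \<Rightarrow> 'c"
  assumes finite_vertices: "finite W"
    and colour_sym: "x \<in> W \<Longrightarrow> y \<in> W \<Longrightarrow> c x y = c y x"
    and colour_inj: "x \<in> W \<Longrightarrow> y \<in> W \<Longrightarrow> z \<in> W \<Longrightarrow> x \<noteq> y \<Longrightarrow> x \<noteq> z \<Longrightarrow> c x y = c x z \<Longrightarrow> y = z"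
begin

text \<open>The edges from \<open>v\<close> to \<open>S\<close> have distinct colours by properness,
  so the only losses are those whose colour already occurs.\<close>

lemma card_pair_colours_insert:
  assumes "S \<subseteq> W" "v \<in> W - S"
  shows "card (pair_colours c (insert v S)) =
    card (pair_colours c S) + (card S - card {x \<in> S. c x v \<in> pair_colours c S})"
proof -
  have fS: "finite S"
    using assms finite_vertices finite_subset by blast
  let ?old = "{x \<in> S. c x v \<in> pair_colours c S}"
  have eq: "pair_colours c (insert v S) = pair_colours c S \<union> (\<lambda>x. c x v) ` (S - ?old)"
  proof (intro equalityI subsetI)
    fix k assume "k \<in> pair_colours c (insert v S)"
    then consider "k \<in> pair_colours c S" | x where "x \<in> S" "k = c x v"
      using assms colour_sym unfolding pair_colours_def by blast
    then show "k \<in> pair_colours c S \<union> (\<lambda>x. c x v) ` (S - ?old)"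
      by cases auto
  next
    fix k assume "k \<in> pair_colours c S \<union> (\<lambda>x. c x v) ` (S - ?old)"
    then show "k \<in> pair_colours c (insert v S)"
      using assms unfolding pair_colours_def by blast
  qed
  have inj: "inj_on (\<lambda>x. c x v) (S - ?old)"
  proof (rule inj_onI)
    fix x y assume "x \<in> S - ?old" "y \<in> S - ?old" "c x v = c y v"
    moreover from this have "x \<in> W" "y \<in> W" "v \<in> W" "v \<noteq> x" "v \<noteq> y"
      using assms by auto
    ultimately show "x = y"
      using colour_inj[of v x y] colour_sym[of x v] colour_sym[of y v] by simp
  qed
  have "card (pair_colours c (insert v S)) =
      card (pair_colours c S) + card ((\<lambda>x. c x v) ` (S - ?old))"
    unfolding eq
  proof (rule card_Un_disjoint)
    show "pair_colours c S \<inter> (\<lambda>x. c x v) ` (S - ?old) = {}" by blast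
  qed (use fS finite_pair_colours in auto)
  also have "card ((\<lambda>x. c x v) ` (S - ?old)) = card S - card ?old"
    using inj fS by (simp add: card_image card_Diff_subset)
  finally show ?thesis .
qed

text \<open>Each vertex \<open>x\<close> of \<open>S\<close> and each old colour determine at most one \<open>v\<close>.\<close>

lemma card_vertices_with_old_colours_le:
  assumes "S \<subseteq> W"
  shows "card {v \<in> W - S. card S < 2 * card {x \<in> S. c x v \<in> pair_colours c S}} \<le> 2 * (card S)\<^sup>2"
    (is "card ?bad \<le> _")
proof (cases "S = {}")
  case True
  then show ?thesis by simp
next
  case False
  have fS: "finite S"
    using assms finite_vertices finite_subset by blast
  let ?P = "pair_colours c S"
  have "card {v \<in> W - S. c x v \<in> ?P} \<le> card S * card S" if "x \<in> S" for x
  proof -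
    have "inj_on (c x) {v \<in> W - S. c x v \<in> ?P}"
    proof (rule inj_onI)
      fix v w assume "v \<in> {v \<in> W - S. c x v \<in> ?P}" "w \<in> {v \<in> W - S. c x v \<in> ?P}" "c x v = c x w"
      then show "v = w"
        using colour_inj[of x v w] assms that by blast
    qed
    then have "card {v \<in> W - S. c x v \<in> ?P} \<le> card ?P"
      by (rule card_inj_on_le) (use fS in \<open>auto simp: finite_pair_colours\<close>)
    also have "\<dots> \<le> card S * card S"
      using fS by (rule card_pair_colours_le)
    finally show ?thesis .
  qed
  then have "(\<Sum>x\<in>S. card {v \<in> W - S. c x v \<in> ?P}) \<le> (\<Sum>x\<in>S. card S * card S)"
    by (intro sum_mono)
  \<comment> \<open>Double counting of the pairs \<open>(x, v)\<close> whose colour is old.\<close>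
  also have "(\<Sum>x\<in>S. card {v \<in> W - S. c x v \<in> ?P}) = (\<Sum>v\<in>W - S. card {x \<in> S. c x v \<in> ?P})"
    using sum.swap_restrict[of S "W - S" "\<lambda>_ _. 1::nat" "\<lambda>x v. c x v \<in> ?P"] fS finite_vertices
    by (simp only: card_eq_sum finite_Diff)
  finally have le: "(\<Sum>v\<in>W - S. card {x \<in> S. c x v \<in> ?P}) \<le> card S * (card S * card S)"
    by simp
  \<comment> \<open>A bad vertex accounts for more than half of \<open>card S\<close> such pairs,
    while there are at most as many as the cube of \<open>card S\<close> in total.\<close>
  have "card ?bad * card S = (\<Sum>v\<in>?bad. card S)"
    by simp
  also have "\<dots> \<le> (\<Sum>v\<in>?bad. 2 * card {x \<in> S. c x v \<in> ?P})"
    by (intro sum_mono) auto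
  also have "\<dots> \<le> (\<Sum>v\<in>W - S. 2 * card {x \<in> S. c x v \<in> ?P})"
    using finite_vertices by (intro sum_mono2) auto
  also have "\<dots> \<le> (2 * (card S)\<^sup>2) * card S"
    using le by (simp add: sum_distrib_left[symmetric] power2_eq_square)
  finally show ?thesis
    by (rule mult_right_le_imp_le) (use False fS in \<open>simp add: card_gt_0_iff\<close>)
qed

text \<open>Up to a factor 2 the weight is the probability that a random 2-colouring of the colours
  is constant on those of the set. A vertex with few old colours brings at least
  \<open>card S div 2\<close> new ones, each halving the weight; the at most
  \<open>2 * (card S)^2\<close> other vertices get the trivial factor 1.\<close>

lemma sum_colour_weights_insert_le:
  assumes "S \<subseteq> W"
  shows "(\<Sum>v\<in>W - S. (1/2) ^ card (pair_colours c (insert v S))) \<le>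
    (1/2::real) ^ card (pair_colours c S) *
      (real (card W) * (1/2) ^ (card S div 2) + 2 * (real (card S))\<^sup>2)"
proof -
  let ?old = "\<lambda>v. {x \<in> S. c x v \<in> pair_colours c S}"
  let ?bad = "{v \<in> W - S. card S < 2 * card (?old v)}"
  let ?h = "(1/2::real) ^ (card S div 2)"
  have "(1/2::real) ^ (card S - card (?old v)) \<le> ?h + (if v \<in> ?bad then 1 else 0)"
    if "v \<in> W - S" for v
  proof (cases "v \<in> ?bad")
    case True
    then show ?thesis by (simp add: power_le_one add_increasing)
  next
    case False
    then have "card S div 2 \<le> card S - card (?old v)"
      using that by auto
    then have "(1/2::real) ^ (card S - card (?old v)) \<le> ?h"
      by (intro power_decreasing) auto
    then show ?thesis by (smt (verit))
  qed
  then have "(\<Sum>v\<in>W - S. (1/2::real) ^ (card S - card (?old v))) \<le>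
      (\<Sum>v\<in>W - S. ?h + (if v \<in> ?bad then 1 else 0))"
    by (intro sum_mono)
  also have "\<dots> = real (card (W - S)) * ?h + real (card ?bad)"
  proof -
    have "(\<Sum>v\<in>W - S. if v \<in> ?bad then 1 else 0::real) = (\<Sum>v\<in>(W - S) \<inter> ?bad. 1)"
      using finite_vertices by (subst sum.inter_restrict) auto
    also have "(W - S) \<inter> ?bad = ?bad" by auto
    finally show ?thesis by (simp add: sum.distrib)
  qed
  also have "\<dots> \<le> real (card W) * ?h + 2 * (real (card S))\<^sup>2"
  proof (rule add_mono)
    show "real (card (W - S)) * ?h \<le> real (card W) * ?h"
      using finite_vertices by (intro mult_right_mono) (auto intro!: card_mono)
    show "real (card ?bad) \<le> 2 * (real (card S))\<^sup>2"
      using card_vertices_with_old_colours_le[OF assms]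
      by (metis (mono_tags, lifting) of_nat_le_iff of_nat_mult of_nat_numeral of_nat_power)
  qed
  finally have "(1/2::real) ^ card (pair_colours c S) *
      (\<Sum>v\<in>W - S. (1/2::real) ^ (card S - card (?old v))) \<le>
      (1/2::real) ^ card (pair_colours c S) *
      (real (card W) * ?h + 2 * (real (card S))\<^sup>2)"
    by (intro mult_left_mono) auto
  moreover have "(\<Sum>v\<in>W - S. (1/2::real) ^ card (pair_colours c (insert v S))) =
      (1/2::real) ^ card (pair_colours c S) *
      (\<Sum>v\<in>W - S. (1/2::real) ^ (card S - card (?old v)))"
    by (simp add: card_pair_colours_insert[OF assms] power_add sum_distrib_left)
  ultimately show ?thesis by simp
qed

text \<open>The one-vertex bound depends on the shorter list only through its weight and its length,
  so the factors multiply.\<close>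

lemma sum_colour_weights_le:
  "(\<Sum>ts\<in>injective_lists W k. (1/2::real) ^ card (pair_colours c (set ts))) \<le>
    (\<Prod>j<k. real (card W) * (1/2) ^ (j div 2) + 2 * (real j)\<^sup>2)"
proof (induction k)
  case 0
  then show ?case by (simp add: injective_lists_0 power_le_one)
next
  case (Suc k)
  let ?B = "real (card W) * (1/2) ^ (k div 2) + 2 * (real k)\<^sup>2"
  have "(\<Sum>ts\<in>injective_lists W (Suc k). (1/2::real) ^ card (pair_colours c (set ts))) =
      (\<Sum>ts\<in>injective_lists W k. \<Sum>v\<in>W - set ts.
        (1/2::real) ^ card (pair_colours c (insert v (set ts))))"
    by (simp add: sum_injective_lists_Suc[OF finite_vertices])
  also have "\<dots> \<le> (\<Sum>ts\<in>injective_lists W k. (1/2::real) ^ card (pair_colours c (set ts)) * ?B)"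
  proof (rule sum_mono)
    fix ts assume "ts \<in> injective_lists W k"
    then have "set ts \<subseteq> W" "card (set ts) = k"
      by (auto simp: injective_lists_def distinct_card)
    then show "(\<Sum>v\<in>W - set ts. (1/2::real) ^ card (pair_colours c (insert v (set ts)))) \<le>
        (1/2::real) ^ card (pair_colours c (set ts)) * ?B"
      using sum_colour_weights_insert_le[of "set ts"] by simp
  qed
  also have "\<dots> \<le> (\<Prod>j<k. real (card W) * (1/2) ^ (j div 2) + 2 * (real j)\<^sup>2) * ?B"
    using Suc by (simp add: sum_distrib_right[symmetric] mult_right_mono)
  finally show ?case by simp
qed

end

section \<open>Counting colourings and vertex subsets\<close>

lemma card_supersets_in_Pow:
  assumes "finite C" "A \<subseteq> C"
  shows "card {F \<in> Pow C. A \<subseteq> F} = 2 ^ (card C - card A)"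
proof -
  have "{F \<in> Pow C. A \<subseteq> F} = (\<lambda>G. A \<union> G) ` Pow (C - A)"
  proof (intro equalityI subsetI)
    fix F assume "F \<in> {F \<in> Pow C. A \<subseteq> F}"
    then have "F = A \<union> (F - A)" "F - A \<in> Pow (C - A)" by auto
    then show "F \<in> (\<lambda>G. A \<union> G) ` Pow (C - A)" by blast
  qed (use assms in auto)
  moreover have "inj_on (\<lambda>G. A \<union> G) (Pow (C - A))"
    by (auto simp: inj_on_def)
  ultimately have "card {F \<in> Pow C. A \<subseteq> F} = card (Pow (C - A))"
    by (simp add: card_image)
  then show ?thesis
    using assms finite_subset[OF assms(2,1)] by (simp add: card_Pow card_Diff_subset)
qed

lemma card_avoiding_in_Pow:
  assumes "finite C" "A \<subseteq> C"
  shows "card {F \<in> Pow C. A \<inter> F = {}} = 2 ^ (card C - card A)"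
proof -
  have "{F \<in> Pow C. A \<inter> F = {}} = Pow (C - A)" by auto
  then show ?thesis
    using assms finite_subset[OF assms(2,1)] by (simp add: card_Pow card_Diff_subset)
qed

text \<open>The ratio of the two binomials is the product of \<open>(r - i) / (n - i)\<close> over
  \<open>i < k\<close>, and each factor is at most \<open>r / n\<close>.\<close>

lemma binomial_diff_le:
  assumes "k \<le> r" "r \<le> n"
  shows "real ((n - k) choose (r - k)) \<le> (real r / real n) ^ k * real (n choose r)"
  using assms
proof (induction k)
  case 0
  then show ?case by simp
next
  case (Suc k)
  have pos: "n - k > 0" "r - k > 0" "n > 0" using Suc.prems by auto
  have "(r - k) * ((n - k) choose (r - k)) = (n - k) * ((n - Suc k) choose (r - Suc k))"
    using pos Suc_times_binomial_eq[of "n - Suc k" "r - Suc k"]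
    by (simp add: Suc_diff_Suc mult.commute)
  then have "real (r - k) * real ((n - k) choose (r - k)) =
      real (n - k) * real ((n - Suc k) choose (r - Suc k))"
    by (metis of_nat_mult)
  then have "real ((n - Suc k) choose (r - Suc k)) =
      real (r - k) / real (n - k) * real ((n - k) choose (r - k))"
    using pos by (simp add: field_simps)
  also have "\<dots> \<le> real r / real n * ((real r / real n) ^ k * real (n choose r))"
  proof (rule mult_mono)
    show "real (r - k) / real (n - k) \<le> real r / real n"
    proof -
      have "real k * real r \<le> real k * real n"
        using Suc.prems by (intro mult_left_mono) auto
      then have "real (r - k) * real n \<le> real r * real (n - k)"
        using Suc.prems by (simp add: of_nat_diff algebra_simps)
      then show ?thesis using pos by (simp add: field_simps)
    qed
  qed (use Suc in auto)
  finally show ?case by simp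
qed

lemma card_nsets_containing_le:
  assumes "finite W" "S \<subseteq> W" "r \<le> card W"
  shows "real (card {X \<in> [W]\<^bsup>r\<^esup>. S \<subseteq> X}) \<le>
    (real r / real (card W)) ^ card S * real (card W choose r)"
proof (cases "card S \<le> r")
  case True
  have fS: "finite S" using assms finite_subset by blast
  have "{X \<in> [W]\<^bsup>r\<^esup>. S \<subseteq> X} \<subseteq> (\<lambda>G. S \<union> G) ` (nsets (W - S) (r - card S))"
  proof
    fix X assume X: "X \<in> {X \<in> [W]\<^bsup>r\<^esup>. S \<subseteq> X}"
    then have "X = S \<union> (X - S)" by auto
    moreover have "X - S \<in> nsets (W - S) (r - card S)"
      using X fS by (auto simp: nsets_def card_Diff_subset)
    ultimately show "X \<in> (\<lambda>G. S \<union> G) ` (nsets (W - S) (r - card S))" by blast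
  qed
  then have "card {X \<in> [W]\<^bsup>r\<^esup>. S \<subseteq> X} \<le> card (nsets (W - S) (r - card S))"
    using assms by (intro surj_card_le) (auto intro: finite_imp_finite_nsets)
  also have "\<dots> = (card W - card S) choose (r - card S)"
    using assms fS by (simp add: card_nsets card_Diff_subset)
  finally show ?thesis
    using binomial_diff_le[OF True assms(3)] by linarith
next
  case False
  have "{X \<in> [W]\<^bsup>r\<^esup>. S \<subseteq> X} = {}"
    using False card_mono by (fastforce simp: nsets_def)
  then show ?thesis by (simp only: card.empty) simp
qed

section \<open>The first moment argument\<close>

context proper_pair_colouring
begin

text \<open>Union bound over all lists: \<open>F\<close> is a random set of colours and
  \<open>X\<close> an independent uniform \<open>r\<close>-subset. Fixing the size of
  \<open>X\<close> gives \<open>card X = r\<close> without a concentration estimate.\<close>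

lemma exists_subset_without_homogeneous_sets:
  assumes "r \<le> card W"
    and small: "2 * (\<Prod>j<k. real r / real (card W) *
      (real (card W) * (1/2) ^ (j div 2) + 2 * (real j)\<^sup>2)) < 1"
  obtains F X where "X \<subseteq> W" "card X = r"
    "\<forall>S\<subseteq>X. card S = k \<longrightarrow> \<not> pair_colours c S \<subseteq> F \<and> pair_colours c S \<inter> F \<noteq> {}"
proof -
  define C where "C = pair_colours c W"
  define hom where "hom = (\<lambda>ts F. pair_colours c (set ts) \<subseteq> F \<or> pair_colours c (set ts) \<inter> F = {})"
  let ?L = "injective_lists W k"
  let ?p = "real r / real (card W)"
  let ?w = "\<lambda>ts. (1/2::real) ^ card (pair_colours c (set ts))"
  have fC: "finite C"
    unfolding C_def using finite_vertices by (rule finite_pair_colours)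
  have fN: "finite ([W]\<^bsup>r\<^esup>)"
    using finite_vertices by (rule finite_imp_finite_nsets)
  have fL: "finite ?L"
    using finite_vertices by (rule finite_injective_lists)
  \<comment> \<open>For a fixed list the conditions on \<open>F\<close> and on \<open>X\<close> are
    independent, so the count factorises. The factor 2 stands for the two ways of being
    homogeneous.\<close>
  have count: "real (card {(F, X) \<in> Pow C \<times> [W]\<^bsup>r\<^esup>. hom ts F \<and> set ts \<subseteq> X}) \<le>
      2 * 2 ^ card C * real (card W choose r) * ?p ^ k * ?w ts" if "ts \<in> ?L" for ts
  proof -
    let ?A = "pair_colours c (set ts)"
    have ts: "set ts \<subseteq> W" "card (set ts) = k"
      using that by (auto simp: injective_lists_def distinct_card)
    have AC: "?A \<subseteq> C"
      unfolding C_def using ts by (intro pair_colours_mono)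
    have "{F \<in> Pow C. hom ts F} = {F \<in> Pow C. ?A \<subseteq> F} \<union> {F \<in> Pow C. ?A \<inter> F = {}}"
      unfolding hom_def by auto
    then have "card {F \<in> Pow C. hom ts F} \<le> 2 * 2 ^ (card C - card ?A)"
      using card_Un_le[of "{F \<in> Pow C. ?A \<subseteq> F}" "{F \<in> Pow C. ?A \<inter> F = {}}"]
        card_supersets_in_Pow[OF fC AC] card_avoiding_in_Pow[OF fC AC] by simp
    then have "real (card {F \<in> Pow C. hom ts F}) \<le> real (2 * 2 ^ (card C - card ?A))"
      by (simp only: of_nat_le_iff)
    also have "\<dots> = 2 * 2 ^ card C * ?w ts"
    proof -
      have "(2::real) ^ card C = 2 ^ (card C - card ?A) * 2 ^ card ?A"
        using card_mono[OF fC AC] by (simp add: power_add[symmetric])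
      then show ?thesis by (simp add: power_one_over)
    qed
    finally have F: "real (card {F \<in> Pow C. hom ts F}) \<le> 2 * 2 ^ card C * ?w ts" .
    have "{(F, X) \<in> Pow C \<times> [W]\<^bsup>r\<^esup>. hom ts F \<and> set ts \<subseteq> X} =
        {F \<in> Pow C. hom ts F} \<times> {X \<in> [W]\<^bsup>r\<^esup>. set ts \<subseteq> X}" by auto
    then have "real (card {(F, X) \<in> Pow C \<times> [W]\<^bsup>r\<^esup>. hom ts F \<and> set ts \<subseteq> X}) =
        real (card {F \<in> Pow C. hom ts F}) * real (card {X \<in> [W]\<^bsup>r\<^esup>. set ts \<subseteq> X})"
      by (simp add: card_cartesian_product)
    also have "\<dots> \<le> (2 * 2 ^ card C * ?w ts) * (?p ^ k * real (card W choose r))"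
      using F card_nsets_containing_le[OF finite_vertices ts(1) assms(1)] ts(2)
      by (intro mult_mono) auto
    finally show ?thesis by (simp add: mult_ac)
  qed
  have "\<exists>F\<in>Pow C. \<exists>X\<in>[W]\<^bsup>r\<^esup>. \<forall>ts\<in>?L. \<not> (hom ts F \<and> set ts \<subseteq> X)"
  proof (rule ccontr)
    assume none: "\<not> ?thesis"
    then have cover: "Pow C \<times> [W]\<^bsup>r\<^esup> \<subseteq>
        (\<Union>ts\<in>?L. {(F, X) \<in> Pow C \<times> [W]\<^bsup>r\<^esup>. hom ts F \<and> set ts \<subseteq> X})" (is "_ \<subseteq> ?U")
    proof (intro subsetI)
      fix FX assume "FX \<in> Pow C \<times> [W]\<^bsup>r\<^esup>"
      then obtain F X where "FX = (F, X)" "F \<in> Pow C" "X \<in> [W]\<^bsup>r\<^esup>" by blast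
      moreover from this none obtain ts where "ts \<in> ?L" "hom ts F" "set ts \<subseteq> X"
        by meson
      ultimately show "FX \<in> ?U" by blast
    qed
    have "card (Pow C \<times> [W]\<^bsup>r\<^esup>) \<le> card ?U"
    proof (rule card_mono[OF _ cover])
      have "finite (Pow C \<times> [W]\<^bsup>r\<^esup>)"
        using fC fN by simp
      then show "finite ?U" by (rule finite_subset[rotated]) blast
    qed
    also have "\<dots> \<le> (\<Sum>ts\<in>?L. card {(F, X) \<in> Pow C \<times> [W]\<^bsup>r\<^esup>. hom ts F \<and> set ts \<subseteq> X})"
      by (rule card_UN_le[OF fL])
    finally have "real (card (Pow C \<times> [W]\<^bsup>r\<^esup>)) \<le>
        (\<Sum>ts\<in>?L. real (card {(F, X) \<in> Pow C \<times> [W]\<^bsup>r\<^esup>. hom ts F \<and> set ts \<subseteq> X}))"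
      by (simp only: of_nat_sum[symmetric] of_nat_le_iff)
    also have "\<dots> \<le> (\<Sum>ts\<in>?L. 2 * 2 ^ card C * real (card W choose r) * ?p ^ k * ?w ts)"
      by (intro sum_mono count)
    also have "\<dots> = 2 ^ card C * real (card W choose r) * (2 * (?p ^ k * (\<Sum>ts\<in>?L. ?w ts)))"
      by (simp add: sum_distrib_left mult_ac)
    also have "\<dots> \<le> 2 ^ card C * real (card W choose r) *
        (2 * (?p ^ k * (\<Prod>j<k. real (card W) * (1/2) ^ (j div 2) + 2 * (real j)\<^sup>2)))"
      by (intro mult_left_mono sum_colour_weights_le) auto
    \<comment> \<open>The \<open>k\<close> copies of \<open>?p\<close> are distributed over the
      \<open>k\<close> factors, as in \<open>small\<close>.\<close>
    also have "\<dots> = 2 ^ card C * real (card W choose r) *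
        (2 * (\<Prod>j<k. ?p * (real (card W) * (1/2) ^ (j div 2) + 2 * (real j)\<^sup>2)))"
      by (subst prod.distrib) simp
    \<comment> \<open>Strict because \<open>r \<le> card W\<close> makes the number of all pairs
      positive.\<close>
    also have "\<dots> < 2 ^ card C * real (card W choose r) * 1"
      using small assms(1) by (intro mult_strict_left_mono) auto
    finally show False
      using fC finite_vertices by (simp add: card_cartesian_product card_Pow card_nsets)
  qed
  then obtain F X where FX: "X \<in> [W]\<^bsup>r\<^esup>" "\<And>ts. ts \<in> ?L \<Longrightarrow> \<not> (hom ts F \<and> set ts \<subseteq> X)"
    by blast
  show thesis
  proof (rule that[of X F])
    show "X \<subseteq> W" "card X = r" using FX(1) by (auto simp: nsets_def)
    have "\<not> pair_colours c S \<subseteq> F \<and> pair_colours c S \<inter> F \<noteq> {}"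
      if S: "S \<subseteq> X" "card S = k" for S
    proof -
      have "finite S"
        using S(1) FX(1) by (auto simp: nsets_def intro: finite_subset)
      then obtain ts where ts: "set ts = S" "distinct ts"
        using finite_distinct_list by blast
      then have "ts \<in> ?L"
        using S FX(1) by (auto simp: injective_lists_def nsets_def distinct_card[symmetric])
      then show ?thesis
        using FX(2)[of ts] S(1) ts(1) unfolding hom_def by auto
    qed
    then show "\<forall>S\<subseteq>X. card S = k \<longrightarrow> \<not> pair_colours c S \<subseteq> F \<and> pair_colours c S \<inter> F \<noteq> {}"
      by (intro allI impI)
  qed
qed

end

section \<open>Chords of parabolas\<close>

text \<open>Enumerating the coordinates and pairing \<open>2 * i\<close> with
  \<open>2 * i + 1\<close> splits the space into \<open>e\<close> coordinate planes, one for each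
  parabola.\<close>

lemma exists_paired_coordinates:
  assumes "CARD('n::finite) = 2 * e"
  obtains p q :: "nat \<Rightarrow> 'n::finite"
  where "\<And>i. i < e \<Longrightarrow> p i \<noteq> q i"
    "\<And>f g. \<exists>v :: real ^ 'n::finite. \<forall>i<e. v $ p i = f i \<and> v $ q i = g i"
proof -
  obtain h :: "nat \<Rightarrow> 'n" where h: "bij_betw h {0..<2 * e} UNIV"
    using ex_bij_betw_nat_finite[of "UNIV :: 'n set"] assms by auto
  define h' where "h' = inv_into {0..<2 * e} h"
  have h'h: "h' (h j) = j" if "j < 2 * e" for j
    unfolding h'_def using h that by (intro inv_into_f_f) (auto simp: bij_betw_def)
  show thesis
  proof (rule that[of "\<lambda>i. h (2 * i)" "\<lambda>i. h (2 * i + 1)"])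
    fix i assume "i < e"
    then have "h' (h (2 * i)) = 2 * i" "h' (h (2 * i + 1)) = 2 * i + 1"
      by (auto intro!: h'h)
    then show "h (2 * i) \<noteq> h (2 * i + 1)" by (metis n_not_Suc_n Suc_eq_plus1)
  next
    fix f g :: "nat \<Rightarrow> real"
    show "\<exists>v :: real ^ 'n. \<forall>i<e. v $ h (2 * i) = f i \<and> v $ h (2 * i + 1) = g i"
      by (intro exI[of _ "\<chi> j. if even (h' j) then f (h' j div 2) else g (h' j div 2)"])
         (auto simp: h'h)
  qed
qed

lemma nat_eq_of_same_below:
  fixes a b B :: nat
  assumes same: "\<And>j. j < B \<Longrightarrow> (j < a) = (j < b)" and "a \<le> B" "b \<le> B"
  shows "a = b"
proof (cases a b rule: linorder_cases)
  case less
  then show ?thesis using same[of a] \<open>b \<le> B\<close> by simp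
next
  case greater
  then show ?thesis using same[of b] \<open>a \<le> B\<close> by simp
qed

text \<open>
  The left-hand side is the form \<open>Y - s X\<close> at the difference of two points \<open>(A, A\<^sup>2)\<close> and
  \<open>(B, B\<^sup>2)\<close> of the parabola, up to a perturbation \<open>t\<close>; its sign compares the slope
  \<open>A + B\<close> of the chord with \<open>s\<close>.
\<close>

lemma sgn_parabola_chord:
  fixes A B j :: nat and t :: real
  assumes "A \<noteq> B" "\<bar>t\<bar> < 1/2"
  shows "sgn ((real A)\<^sup>2 - (real B)\<^sup>2 - (real j + 1/2) * (real A - real B) - t) =
    sgn (real A - real B) * (if j < A + B then 1 else -1)"
proof -
  \<comment> \<open>\<open>P\<close> is the unperturbed form. The integer \<open>A + B\<close> has
    distance at least 1/2 from the half-integer threshold and the other factor is at least 1 in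
    absolute value, so \<open>t\<close> cannot change the sign.\<close>
  define P where "P = (real A - real B) * (real A + real B - (real j + 1/2))"
  have "\<bar>real A - real B\<bar> \<ge> 1"
    using assms(1) by linarith
  moreover have "\<bar>real A + real B - (real j + 1/2)\<bar> \<ge> 1/2"
  proof (cases "j < A + B")
    case True
    then have "real j + 1 \<le> real A + real B" by linarith
    then show ?thesis by linarith
  next
    case False
    then have "real A + real B \<le> real j" by linarith
    then show ?thesis by linarith
  qed
  ultimately have "\<bar>P\<bar> \<ge> 1 * (1/2)"
    unfolding P_def abs_mult by (intro mult_mono) auto
  then have "sgn (P - t) = sgn P"
    using assms(2) by (auto simp: sgn_real_def abs_real_def split: if_splits)
  also have "sgn P = sgn (real A - real B) * sgn (real A + real B - (real j + 1/2))"
    unfolding P_def by (rule sgn_mult)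
  also have "sgn (real A + real B - (real j + 1/2)) = (if j < A + B then 1 else -1)"
  proof (cases "j < A + B")
    case True
    then have "real j + 1 \<le> real A + real B" by linarith
    then show ?thesis using True by (simp add: sgn_real_def)
  next
    case False
    then have "real A + real B \<le> real j" by linarith
    then show ?thesis using False by (simp add: sgn_real_def)
  qed
  finally show ?thesis
    by (simp add: P_def power2_eq_square algebra_simps)
qed

text \<open>
  The point of \<open>w\<close> has the coordinates \<open>(w i + \<delta> \<cdot> \<phi> w, (w i)\<^sup>2)\<close> for \<open>i < e\<close>, with \<open>\<phi>\<close> injective.
  The perturbation \<open>\<delta>\<close> keeps the forms nonzero where two points agree in the \<open>i\<close>-th entry; their
  signs are then constant in the threshold, whereas otherwise they change at \<open>w i + w' i\<close>.
\<close>

lemma exists_points_with_proper_sign_vectors: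
  fixes e m D :: nat
  assumes card: "CARD('n::finite) = 2 * e" and "e > 0" and thresholds: "2 * m * e \<le> D"
  obtains a :: "nat \<Rightarrow> real ^ 'n" and W :: "(real ^ 'n) set"
  where "\<And>r. a r \<noteq> 0" "card W = m ^ e" "separated D a W"
    "proper_pair_colouring W (\<lambda>x y. {sign_vector D a (x - y), sign_vector D a (y - x)})"
proof -
  obtain p q :: "nat \<Rightarrow> 'n" where pq: "\<And>i. i < e \<Longrightarrow> p i \<noteq> q i"
    and coords: "\<And>f g. \<exists>v :: real ^ 'n. \<forall>i<e. v $ p i = f i \<and> v $ q i = g i"
    using exists_paired_coordinates[OF card] by metis
  \<comment> \<open>Extensional functions, so that agreement on all entries below \<open>e\<close>
    means equality.\<close>
  define I where "I = {..<e} \<rightarrow>\<^sub>E {..<m}"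
  have fI: "finite I" and cardI: "card I = m ^ e"
    unfolding I_def by (auto simp: card_PiE intro!: finite_PiE)
  obtain \<phi> where \<phi>: "bij_betw \<phi> I {0..<card I}"
    using ex_bij_betw_finite_nat[OF fI] by blast
  \<comment> \<open>Small enough that the perturbation stays below 1/2 for every threshold up to
    \<open>D + 1/2\<close>.\<close>
  define \<delta> :: real where "\<delta> = 1 / (2 * (real D + 1) * (real (card I) + 1))"
  have \<delta>: "\<delta> > 0" unfolding \<delta>_def by simp
  have "\<forall>w. \<exists>v :: real ^ 'n. \<forall>i<e. v $ p i = real (w i) + \<delta> * real (\<phi> w) \<and> v $ q i = (real (w i))\<^sup>2"
    by (intro allI coords)
  then obtain u :: "(nat \<Rightarrow> nat) \<Rightarrow> real ^ 'n" where u: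
    "\<And>w i. i < e \<Longrightarrow> u w $ p i = real (w i) + \<delta> * real (\<phi> w)"
    "\<And>w i. i < e \<Longrightarrow> u w $ q i = (real (w i))\<^sup>2"
    by metis
  \<comment> \<open>The index \<open>r\<close> encodes the plane \<open>r mod e\<close> and the
    threshold \<open>r div e\<close>. The first \<open>2 * m * e\<close> indices run through all
    thresholds below \<open>2 * m\<close> in every plane.\<close>
  define a :: "nat \<Rightarrow> real ^ 'n" where
    "a = (\<lambda>r. axis (q (r mod e)) 1 - (real (r div e) + 1/2) *\<^sub>R axis (p (r mod e)) 1)"
  have a_nz: "a r \<noteq> 0" for r
  proof -
    have "a r $ q (r mod e) = 1"
      using pq[of "r mod e"] \<open>e > 0\<close> by (simp add: a_def axis_def)
    then show ?thesis by auto
  qed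
  have a_inner: "a r \<bullet> x = x $ q (r mod e) - (real (r div e) + 1/2) * x $ p (r mod e)" for r x
    by (simp add: a_def inner_diff_left inner_axis inner_commute[of "axis _ _"])
  have perturb: "\<bar>(real j + 1/2) * (\<delta> * (real (\<phi> w) - real (\<phi> w')))\<bar> < 1/2"
    if "w \<in> I" "w' \<in> I" "j \<le> D" for w w' j
  proof -
    have "\<phi> w < card I" "\<phi> w' < card I"
      using \<phi> that by (auto simp: bij_betw_def)
    then have "\<bar>real (\<phi> w) - real (\<phi> w')\<bar> < real (card I) + 1" by linarith
    moreover have "\<bar>real j + 1/2\<bar> < real D + 1" using that(3) by simp
    ultimately have "\<bar>real j + 1/2\<bar> * \<bar>real (\<phi> w) - real (\<phi> w')\<bar> <
        (real D + 1) * (real (card I) + 1)"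
      by (intro mult_strict_mono) auto
    then have "\<delta> * (\<bar>real j + 1/2\<bar> * \<bar>real (\<phi> w) - real (\<phi> w')\<bar>) <
        \<delta> * ((real D + 1) * (real (card I) + 1))"
      using \<delta> by (intro mult_strict_left_mono)
    also have "\<dots> = 1/2" unfolding \<delta>_def by (simp add: divide_simps)
    finally show ?thesis using \<delta> by (simp add: abs_mult mult_ac)
  qed
  have sgn_form: "sgn (a r \<bullet> (u w - u w')) =
      (if w (r mod e) = w' (r mod e) then - sgn (real (\<phi> w) - real (\<phi> w'))
       else sgn (real (w (r mod e)) - real (w' (r mod e))) *
         (if r div e < w (r mod e) + w' (r mod e) then 1 else -1))"
    if w: "w \<in> I" "w' \<in> I" "r < D" for w w' r
  proof -
    let ?i = "r mod e" and ?s = "real (r div e) + 1/2"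
    have i: "?i < e" using \<open>e > 0\<close> by simp
    have form: "a r \<bullet> (u w - u w') = (real (w ?i))\<^sup>2 - (real (w' ?i))\<^sup>2 -
        ?s * (real (w ?i) - real (w' ?i)) - ?s * (\<delta> * (real (\<phi> w) - real (\<phi> w')))"
      unfolding a_inner vector_minus_component u[OF i] by (simp add: algebra_simps)
    show ?thesis
    proof (cases "w ?i = w' ?i")
      case True
      have "?s > 0" by (simp add: add_nonneg_pos)
      then have "sgn ?s = 1" by simp
      moreover have "a r \<bullet> (u w - u w') = - (?s * (\<delta> * (real (\<phi> w) - real (\<phi> w'))))"
        unfolding form using True by simp
      ultimately show ?thesis
        using True \<delta> by (simp only: sgn_minus sgn_mult) simp
    next
      case False
      have "r div e \<le> D" using w(3) by (meson div_le_dividend le_trans less_imp_le)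
      then show ?thesis
        unfolding form using sgn_parabola_chord[OF False perturb[OF w(1,2)]] False by simp
    qed
  qed
  have \<phi>_inj: "\<phi> w \<noteq> \<phi> w'" if "w \<in> I" "w' \<in> I" "w \<noteq> w'" for w w'
    using \<phi> that by (meson bij_betw_def inj_onD)
  have nonzero: "a r \<bullet> (u w - u w') \<noteq> 0" if "w \<in> I" "w' \<in> I" "w \<noteq> w'" "r < D" for w w' r
  proof -
    have "sgn (a r \<bullet> (u w - u w')) \<noteq> 0"
      unfolding sgn_form[OF that(1,2,4)] using \<phi>_inj[OF that(1-3)]
      by (auto simp: sgn_eq_0_iff split: if_splits)
    then show ?thesis by auto
  qed
  \<comment> \<open>On \<open>I\<close> the default \<open>2 * m\<close> exceeds every tested
    threshold and every sum of two entries, which is at most \<open>2 * m - 2\<close>. So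
    \<open>\<tau> w w' i\<close> together with \<open>w i\<close> determines
    \<open>w' i\<close>.\<close>
  define \<tau> :: "(nat \<Rightarrow> nat) \<Rightarrow> (nat \<Rightarrow> nat) \<Rightarrow> nat \<Rightarrow> nat" where "\<tau> = (\<lambda>w w' i. if w i = w' i then 2 * m else w i + w' i)"
  \<comment> \<open>Index \<open>i\<close> is threshold 0 in plane \<open>i\<close>; multiplying by
    its sign cancels the orientation of the pair. For different entries the sum is positive, so this
    sign is that of \<open>w i - w' i\<close>; for equal entries both signs coincide.\<close>
  have ratio: "sgn (a i \<bullet> (u w - u w')) * sgn (a (j * e + i) \<bullet> (u w - u w')) =
      (if j < \<tau> w w' i then 1 else -1)"
    if w: "w \<in> I" "w' \<in> I" "w \<noteq> w'" "i < e" "j < 2 * m" for w w' i j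
  proof -
    have "j * e + i < Suc j * e" using w(4) by simp
    also have "\<dots> \<le> 2 * m * e" using w(5) by (intro mult_le_mono1) simp
    finally have less: "j * e + i < D" using thresholds by simp
    then have "i < D" by simp
    moreover have "0 < w i + w' i" if "w i \<noteq> w' i" using that by linarith
    ultimately show ?thesis
      using sgn_form[OF w(1,2) less] sgn_form[OF w(1,2) \<open>i < D\<close>] w(4,5) \<phi>_inj[OF w(1-3)]
      by (auto simp: \<tau>_def sgn_real_def)
  qed
  show thesis
  proof (rule that[of a "u ` I"])
    have D: "D > 0" if "I \<noteq> {}"
    proof -
      have "m > 0"
        using that \<open>e > 0\<close> unfolding I_def by (auto simp: PiE_eq_empty_iff)
      then show ?thesis using thresholds \<open>e > 0\<close> by (cases D) auto
    qed
    have "inj_on u I"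
    proof (rule inj_onI, rule ccontr)
      fix w w' assume "w \<in> I" "w' \<in> I" "u w = u w'" "w \<noteq> w'"
      then show False using nonzero[of w w' 0] D by auto
    qed
    then show "card (u ` I) = m ^ e" using cardI by (simp add: card_image)
    show "separated D a (u ` I)"
      unfolding separated_def using nonzero by (auto; metis)
    have proper: "y = z" if xyz: "x \<in> u ` I" "y \<in> u ` I" "z \<in> u ` I" "x \<noteq> y" "x \<noteq> z"
      and eq: "{sign_vector D a (x - y), sign_vector D a (y - x)} =
        {sign_vector D a (x - z), sign_vector D a (z - x)}" for x y z
    proof -
      obtain w wy wz where w: "x = u w" "w \<in> I" "y = u wy" "wy \<in> I" "z = u wz" "wz \<in> I"
        using xyz by blast
      then have ne: "w \<noteq> wy" "w \<noteq> wz" using xyz by auto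
      have "sign_vector D a (x - y) = sign_vector D a (x - z) \<or>
          sign_vector D a (x - y) = sign_vector D a (- (x - z))"
        using eq by (auto simp: doubleton_eq_iff)
      \<comment> \<open>Equal colours mean equal sign vectors up to a global sign \<open>b\<close>,
        which drops out of the products in \<open>ratio\<close> because
        \<open>b * b = 1\<close>.\<close>
      then obtain b :: real where b: "b * b = 1"
        "\<And>r. r < D \<Longrightarrow> sgn (a r \<bullet> (x - y)) = b * sgn (a r \<bullet> (x - z))"
      proof
        assume "sign_vector D a (x - y) = sign_vector D a (x - z)"
        then show thesis using that[of 1] by (auto simp: sign_vector_eq_iff)
      next
        assume "sign_vector D a (x - y) = sign_vector D a (- (x - z))"
        then show thesis using that[of "-1"]
          unfolding sign_vector_eq_iff inner_minus_right sgn_minus by auto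
      qed
      have "wy i = wz i" if i: "i < e" for i
      proof -
        have "(j < \<tau> w wy i) = (j < \<tau> w wz i)" if j: "j < 2 * m" for j
        proof -
          have "j * e + i < Suc j * e" using i by simp
          also have "\<dots> \<le> 2 * m * e" using j by (intro mult_le_mono1) simp
          finally have less: "j * e + i < D" using thresholds by simp
          then have "i < D" by simp
          have "sgn (a i \<bullet> (x - y)) * sgn (a (j * e + i) \<bullet> (x - y)) =
              (b * b) * (sgn (a i \<bullet> (x - z)) * sgn (a (j * e + i) \<bullet> (x - z)))"
            unfolding b(2)[OF less] b(2)[OF \<open>i < D\<close>] by (simp add: mult_ac)
          then show ?thesis
            using ratio[OF w(2,4) ne(1) i j] ratio[OF w(2,6) ne(2) i j] b(1)
            unfolding w(1,3,5) by (auto split: if_splits)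
        qed
        moreover have "w i < m" "wy i < m" "wz i < m"
          using w(2,4,6) i unfolding I_def by auto
        then have "\<tau> w wy i \<le> 2 * m" "\<tau> w wz i \<le> 2 * m"
          unfolding \<tau>_def by auto
        ultimately have "\<tau> w wy i = \<tau> w wz i"
          by (rule nat_eq_of_same_below)
        then show ?thesis
          using \<open>w i < m\<close> \<open>wy i < m\<close> \<open>wz i < m\<close> unfolding \<tau>_def by (auto split: if_splits)
      qed
      then have "wy = wz"
        using w(4,6) unfolding I_def by (intro PiE_ext) auto
      then show "y = z" using w by simp
    qed
    show "proper_pair_colouring (u ` I) (\<lambda>x y. {sign_vector D a (x - y), sign_vector D a (y - x)})"
    proof
      show "finite (u ` I)" using fI by simp
    next
      show "{sign_vector D a (x - y), sign_vector D a (y - x)} =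
          {sign_vector D a (y - x), sign_vector D a (x - y)}" for x y
        by (rule insert_commute)
    qed (rule proper)
  qed (rule a_nz)
qed

section \<open>Estimates for large degree\<close>

lemma prod_le_two_ranges:
  fixes f :: "nat \<Rightarrow> real"
  assumes "\<And>j. j < a \<Longrightarrow> f j \<le> B" "\<And>j. a \<le> j \<Longrightarrow> j < a + b \<Longrightarrow> f j \<le> c" "\<And>j. f j \<ge> 0"
  shows "(\<Prod>j<a + b. f j) \<le> B ^ a * c ^ b"
proof -
  have "(\<Prod>j<a + b. f j) = (\<Prod>j<a. f j) * (\<Prod>j=a..<a + b. f j)"
    by (simp add: lessThan_atLeast0 prod.atLeastLessThan_concat)
  also have "(\<Prod>j<a. f j) \<le> (\<Prod>j<a. B)"
    using assms by (intro prod_mono) auto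
  then have "(\<Prod>j<a. f j) * (\<Prod>j=a..<a + b. f j) \<le> (\<Prod>j<a. B) * (\<Prod>j=a..<a + b. c)"
    using assms by (intro mult_mono prod_mono prod_nonneg) (auto intro: order_trans)
  finally show ?thesis by simp
qed

text \<open>Bounds the set size used below, \<open>2 * (8 * d + 1) * h + 8\<close> with
  \<open>h \<le> (2 * d + 1) * ln D\<close>, by a multiple of \<open>ln D\<close>.\<close>

definition clique_const :: "nat \<Rightarrow> real" where
  "clique_const d = 2 * (2 * real d + 1) * (8 * real d + 1) + 8"

lemma clique_const_ge_8: "clique_const d \<ge> 8"
  unfolding clique_const_def by simp

text \<open>The condition with exponents -1/4 and -1/8 lets the sampling density absorb a
  polylogarithmic factor. The last one turns \<open>k \<le> clique_const d * ln D\<close> into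
  \<open>ln k < 12/11 * ln (ln D)\<close>.\<close>

definition large_degree :: "nat \<Rightarrow> nat \<Rightarrow> bool" where
  "large_degree d D \<longleftrightarrow> 3 \<le> D \<and> 2 * d \<le> D \<and> 1 \<le> ln (real D) \<and>
     2 + 2 * (clique_const d)\<^sup>2 * (ln (real D))\<^sup>2 \<le> real D \<and>
     (6 * (clique_const d)\<^sup>2 * (2 * real d) ^ d) * (ln (real D))\<^sup>2 * real D powr (-1/4) \<le>
       real D powr (-1/8) \<and>
     ln (clique_const d) + ln (ln (real D)) < 12 / 11 * ln (ln (real D))"

lemma eventually_large_degree: "eventually (large_degree d) at_top"
proof -
  have lim: "filterlim real at_top sequentially"
    by (rule filterlim_real_sequentially)
  have C: "clique_const d > 0"
    using clique_const_ge_8[of d] by linarith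
  define A where "A = clique_const d"
  define B where "B = 6 * (clique_const d)\<^sup>2 * (2 * real d) ^ d"
  have "A > 0" using C by (simp add: A_def)
  have "B \<ge> 0" by (simp add: B_def)
  have "\<forall>\<^sub>F x::real in at_top. 1 \<le> ln x"
    by real_asymp
  moreover have "\<forall>\<^sub>F x::real in at_top. 2 + 2 * A\<^sup>2 * (ln x)\<^sup>2 \<le> x"
    using \<open>A > 0\<close> by real_asymp
  moreover have "\<forall>\<^sub>F x::real in at_top. (B + 1) * (ln x)\<^sup>2 * x powr (-1/4) \<le> x powr (-1/8)"
    using \<open>B \<ge> 0\<close> by real_asymp
  moreover have "\<forall>\<^sub>F x::real in at_top. ln A + ln (ln x) < 12 / 11 * ln (ln x)"
    by real_asymp
  moreover have "\<forall>\<^sub>F x::real in at_top. real (max 3 (2 * d)) \<le> x"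
    by (rule eventually_ge_at_top)
  ultimately have "\<forall>\<^sub>F x::real in at_top. 1 \<le> ln x \<and> 2 + 2 * A\<^sup>2 * (ln x)\<^sup>2 \<le> x \<and>
      (B + 1) * (ln x)\<^sup>2 * x powr (-1/4) \<le> x powr (-1/8) \<and>
      ln A + ln (ln x) < 12 / 11 * ln (ln x) \<and> real (max 3 (2 * d)) \<le> x"
    by eventually_elim auto
  from eventually_compose_filterlim[OF this lim] show ?thesis
  proof eventually_elim
    case (elim D)
    have "B * (ln (real D))\<^sup>2 * real D powr (-1/4) \<le> (B + 1) * (ln (real D))\<^sup>2 * real D powr (-1/4)"
      by (intro mult_right_mono) auto
    also have "\<dots> \<le> real D powr (-1/8)"
      using elim by simp
    finally show ?case
      using elim unfolding large_degree_def B_def[symmetric] unfolding A_def[symmetric] by simp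
  qed
qed

text \<open>Up to constants the density \<open>r / M\<close> is at most
  \<open>D powr (- e / 4)\<close>. The first \<open>2 * h\<close> factors are at most
  \<open>D ^ d\<close>; from then on \<open>M * (1/2) ^ (j div 2) \<le> 1\<close>, so the low
  density brings each factor below \<open>D powr (-1/8)\<close>.\<close>

lemma small_first_moment:
  assumes large: "large_degree d D" and d: "d = 2 * e" "e > 0"
  defines "M \<equiv> (D div d) ^ e" and "r \<equiv> nat \<lceil>real D powr (3 / 4 * real e)\<rceil>"
  obtains k where "k > 0" "real k \<le> clique_const d * ln (real D)" "r \<le> M"
    "2 * (\<Prod>j<k. real r / real M * (real M * (1/2) ^ (j div 2) + 2 * (real j)\<^sup>2)) < 1"
proof -
  define L where "L = ln (real D)"
  define C where "C = clique_const d"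
  have D: "D \<ge> 3" "2 * d \<le> D" and L1: "L \<ge> 1" and L2: "2 + 2 * C\<^sup>2 * L\<^sup>2 \<le> real D"
    and L3: "(6 * C\<^sup>2 * (2 * real d) ^ d) * L\<^sup>2 * real D powr (-1/4) \<le> real D powr (-1/8)"
    using large unfolding large_degree_def L_def C_def by auto
  have d1: "d \<ge> 2" "d \<ge> e" using d by auto
  \<comment> \<open>\<open>h\<close> ensures \<open>M \<le> D ^ d \<le> 2 ^ h\<close>, using
    \<open>ln 2 \<ge> 1/2\<close>. The \<open>8 * (2 * h * d + 1)\<close> tail factors cancel the
    \<open>D ^ (2 * h * d)\<close> of the beginning and leave \<open>1 / D\<close>.\<close>
  define h where "h = nat \<lceil>2 * real d * L\<rceil>"
  define k where "k = 2 * h + 8 * (2 * h * d + 1)"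
  have h_ge: "real h \<ge> 2 * real d * L" unfolding h_def by linarith
  have "2 * real d * L \<ge> 0" using L1 by simp
  then have "real h \<le> 2 * real d * L + 1" unfolding h_def by linarith
  also have "\<dots> \<le> (2 * real d + 1) * L" using L1 by (simp add: algebra_simps)
  finally have h_le: "real h \<le> (2 * real d + 1) * L" .
  have "real k = 2 * (8 * real d + 1) * real h + 8"
    unfolding k_def by (simp add: algebra_simps)
  also have "\<dots> \<le> 2 * (8 * real d + 1) * ((2 * real d + 1) * L) + 8 * L"
    using h_le L1 by (intro add_mono mult_left_mono) auto
  also have "\<dots> = C * L" unfolding C_def clique_const_def by (simp add: algebra_simps)
  finally have k_le: "real k \<le> C * L" .
  have k_pos: "k > 0" unfolding k_def by simp
  have k_sq: "(real k)\<^sup>2 \<le> C\<^sup>2 * L\<^sup>2"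
    using k_le by (simp add: power_mult_distrib[symmetric] power_mono)
  have M_le: "real M \<le> real D ^ d"
  proof -
    have "M \<le> D ^ e" unfolding M_def by (intro power_mono) auto
    also have "\<dots> \<le> D ^ d" using D d1 by (intro power_increasing) auto
    finally show ?thesis by (metis of_nat_le_iff of_nat_power)
  qed
  have M_half: "real M * (1/2) ^ h \<le> 1"
  proof -
    have "real D ^ d = exp (real d * L)"
      unfolding L_def using D by (simp add: exp_of_nat_mult)
    also have "\<dots> \<le> exp (real h * ln 2)"
    proof -
      have "ln (2::real) \<ge> 1/2" using ln2_ge_two_thirds by linarith
      then have "real h * ln 2 \<ge> real h * (1/2)" by (intro mult_left_mono) auto
      then show ?thesis using h_ge by simp
    qed
    also have "\<dots> = 2 ^ h" by (simp add: exp_of_nat_mult)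
    finally have "real M \<le> 2 ^ h" using M_le by linarith
    then show ?thesis by (simp add: power_one_over field_simps)
  qed
  have M_ge: "real M \<ge> real D ^ e / (2 * real d) ^ e"
  proof -
    \<comment> \<open>Rounding down loses at most a factor 2, since the integer quotient is at least
      1.\<close>
    have "real (D div d) \<ge> real D / (2 * real d)"
    proof -
      have "D < (D div d + 1) * d"
        using d1 by (metis Suc_eq_plus1 dividend_less_div_times mult.commute mult_Suc
            add.commute less_le_trans not_numeral_le_zero gr0I)
      moreover have "1 \<le> D div d" using D d1 by (simp add: div_greater_zero_iff Suc_le_eq)
      then have "(D div d + 1) * d \<le> (2 * (D div d)) * d" by (intro mult_le_mono1) simp
      ultimately have "D \<le> (2 * (D div d)) * d" by linarith
      then have "D \<le> D div d * (2 * d)" by (simp only: mult_ac)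
      then have "real D \<le> real (D div d) * (2 * real d)"
        by (metis of_nat_le_iff of_nat_mult of_nat_numeral)
      then show ?thesis using d1 by (simp add: field_simps)
    qed
    then have "(real D / (2 * real d)) ^ e \<le> real (D div d) ^ e"
      by (intro power_mono) auto
    then show ?thesis unfolding M_def by (simp add: power_divide)
  qed
  have M_pos: "real M > 0"
  proof -
    have "real D ^ e / (2 * real d) ^ e > 0" using D d1 by simp
    then show ?thesis using M_ge by linarith
  qed
  define p where "p = real r / real M"
  have p0: "p \<ge> 0" unfolding p_def by simp
  have r_le': "real r \<le> real D powr (3 / 4 * real e) + 1"
  proof -
    have "real D powr (3 / 4 * real e) \<ge> 0" by simp
    then show ?thesis unfolding r_def by linarith
  qed
  have r_le: "real r \<le> 2 * real D powr (3 / 4 * real e)"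
  proof -
    have "real D powr (3 / 4 * real e) \<ge> 1" using D by (intro ge_one_powr_ge_zero) auto
    then show ?thesis using r_le' by linarith
  qed
  have p_le: "p \<le> 2 * (2 * real d) ^ d * real D powr (-1/4)"
  proof -
    have "p \<le> (2 * real D powr (3 / 4 * real e)) / (real D ^ e / (2 * real d) ^ e)"
      unfolding p_def using r_le M_ge D d1 by (intro frac_le) auto
    also have "\<dots> = 2 * (2 * real d) ^ e * (real D powr (3 / 4 * real e) / real D powr real e)"
      using D by (simp add: powr_realpow)
    also have "\<dots> = 2 * (2 * real d) ^ e * real D powr (- (real e / 4))"
      by (simp add: powr_diff[symmetric])
    also have "\<dots> \<le> 2 * (2 * real d) ^ d * real D powr (-1/4)"
      using D d d1 by (intro mult_mono power_increasing powr_mono) auto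
    finally show ?thesis .
  qed
  have tail: "3 * (C\<^sup>2 * L\<^sup>2) * p \<le> real D powr (-1/8)"
  proof -
    have "3 * (C\<^sup>2 * L\<^sup>2) * p \<le> 3 * (C\<^sup>2 * L\<^sup>2) * (2 * (2 * real d) ^ d * real D powr (-1/4))"
      using p_le by (intro mult_left_mono) auto
    also have "\<dots> = (6 * C\<^sup>2 * (2 * real d) ^ d) * L\<^sup>2 * real D powr (-1/4)"
      by simp
    finally show ?thesis using L3 by linarith
  qed
  have CL: "C\<^sup>2 * L\<^sup>2 \<ge> 1"
  proof -
    have "real k \<ge> 1" using k_pos by simp
    then have "(real k)\<^sup>2 \<ge> 1" by (rule one_le_power)
    then show ?thesis using k_sq by linarith
  qed
  have p1: "p \<le> 1"
  proof -
    have "1 * p \<le> 3 * (C\<^sup>2 * L\<^sup>2) * p" using CL p0 by (intro mult_right_mono) auto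
    moreover have "real D powr (-1/8) \<le> 1"
      using D powr_mono[of "-1/8" 0 "real D"] by simp
    ultimately show ?thesis using tail by linarith
  qed
  have "r \<le> M"
    using p1 M_pos unfolding p_def by (simp add: divide_le_eq)
  moreover have "2 * (\<Prod>j<k. p * (real M * (1/2) ^ (j div 2) + 2 * (real j)\<^sup>2)) < 1"
  proof -
    let ?f = "\<lambda>j. p * (real M * (1/2) ^ (j div 2) + 2 * (real j)\<^sup>2)"
    have j_sq: "(real j)\<^sup>2 \<le> C\<^sup>2 * L\<^sup>2" if "j < k" for j
    proof -
      have "(real j)\<^sup>2 \<le> (real k)\<^sup>2" using that by (intro power_mono) auto
      then show ?thesis using k_sq by linarith
    qed
    have "(\<Prod>j<k. ?f j) \<le> (real D ^ d) ^ (2 * h) * (real D powr (-1/8)) ^ (8 * (2 * h * d + 1))"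
      unfolding k_def
    proof (rule prod_le_two_ranges)
      \<comment> \<open>Crude bound: \<open>r \<le> D ^ e + 1\<close>, the polylogarithmic term is
        at most \<open>D - 2\<close>, and
        \<open>D ^ e + D - 1 \<le> D ^ (e + 1) \<le> D ^ d\<close>.\<close>
      fix j assume j: "j < 2 * h"
      then have "j < k" unfolding k_def by simp
      have "?f j \<le> p * (real M * 1 + 2 * (C\<^sup>2 * L\<^sup>2))"
        using p0 j_sq[OF \<open>j < k\<close>] by (intro mult_left_mono add_mono) (auto simp: power_le_one)
      also have "\<dots> = real r + p * (2 * (C\<^sup>2 * L\<^sup>2))"
        using M_pos unfolding p_def by (simp add: field_simps)
      also have "\<dots> \<le> (real D powr (3 / 4 * real e) + 1) + 1 * (2 * (C\<^sup>2 * L\<^sup>2))"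
        using r_le' p1 by (intro add_mono mult_right_mono) auto
      also have "\<dots> \<le> real D ^ e + (real D - 1)"
      proof -
        have "real D powr (3 / 4 * real e) \<le> real D powr real e"
          using D by (intro powr_mono) auto
        then show ?thesis using L2 D by (simp add: powr_realpow)
      qed
      also have "\<dots> \<le> real D ^ e * real D"
      proof -
        have "real D ^ e \<ge> 1" using D by (intro one_le_power) auto
        then have "(real D ^ e - 1) * (real D - 1) \<ge> 0" using D by (intro mult_nonneg_nonneg) auto
        then show ?thesis by (simp add: algebra_simps)
      qed
      also have "\<dots> = real D ^ Suc e" by simp
      also have "\<dots> \<le> real D ^ d" using D d by (intro power_increasing) auto
      finally show "?f j \<le> real D ^ d" .
    next
      fix j assume j: "2 * h \<le> j" "j < 2 * h + 8 * (2 * h * d + 1)"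
      then have "j < k" unfolding k_def by simp
      have "(1/2::real) ^ (j div 2) \<le> (1/2) ^ h" using j by (intro power_decreasing) auto
      then have "real M * (1/2) ^ (j div 2) \<le> real M * (1/2) ^ h" by (intro mult_left_mono) auto
      then have "?f j \<le> p * (1 + 2 * (C\<^sup>2 * L\<^sup>2))"
        using p0 j_sq[OF \<open>j < k\<close>] M_half by (intro mult_left_mono add_mono) auto
      also have "\<dots> \<le> p * (3 * (C\<^sup>2 * L\<^sup>2))"
        using p0 CL by (intro mult_left_mono) auto
      finally show "?f j \<le> real D powr (-1/8)" using tail by (simp add: mult_ac)
    next
      show "?f j \<ge> 0" for j using p0 by auto
    qed
    also have "(real D powr (-1/8)) ^ (8 * (2 * h * d + 1)) = 1 / real D ^ (2 * h * d + 1)"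
    proof -
      have "(real D powr (-1/8)) ^ 8 = real D powr (-1/8 * real 8)"
        using D by (subst powr_power) auto
      also have "\<dots> = 1 / real D"
        using D powr_minus_divide[of "real D" 1] by simp
      finally have "(real D powr (-1/8)) ^ 8 = 1 / real D" .
      then show ?thesis by (simp only: power_mult power_one_over)
    qed
    also have "(real D ^ d) ^ (2 * h) * (1 / real D ^ (2 * h * d + 1)) = 1 / real D"
      using D by (simp add: power_mult[symmetric] mult_ac)
    finally have "2 * (\<Prod>j<k. ?f j) \<le> 2 / real D" by simp
    also have "\<dots> < 1" using D by simp
    finally show ?thesis .
  qed
  ultimately show thesis
    using that k_pos k_le unfolding p_def C_def L_def by blast
qed

text \<open>Since \<open>N = D powr (d * y)\<close> and \<open>r \<ge> D powr (3 * d / 8)\<close>,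
  rounding \<open>8 * y / 3\<close> up gives enough levels; \<open>y \<ge> 1\<close> absorbs the
  rounding into \<open>11 * y / 3\<close>.\<close>

lemma exists_number_of_levels:
  assumes large: "large_degree d D" and d: "d = 2 * e" "e > 0"
    and N: "D ^ d \<le> N" and k: "k > 0" "real k \<le> clique_const d * ln (real D)"
  defines "r \<equiv> nat \<lceil>real D powr (3 / 4 * real e)\<rceil>"
  obtains n where "N \<le> r ^ n"
    "real k ^ n < real N powr (4 * (ln (ln (real D)) / (real d * ln (real D))))"
proof -
  define L where "L = ln (real D)"
  have D: "D \<ge> 3" and L1: "L \<ge> 1" and L4: "ln (clique_const d) + ln L < 12 / 11 * ln L"
    using large unfolding large_degree_def L_def by auto
  define y where "y = ln (real N) / (real d * L)"
  have d_pos: "real d > 0" using d by simp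
  have "D ^ d > 0" using D by simp
  then have N_pos: "real N > 0" using N by linarith
  have "real d * L = ln (real D ^ d)"
    unfolding L_def using D by (simp add: ln_realpow)
  also have "\<dots> \<le> ln (real N)"
    using D N N_pos by (subst ln_le_cancel_iff) (auto simp flip: of_nat_power)
  finally have y1: "y \<ge> 1" unfolding y_def using d_pos L1 by (simp add: le_divide_eq)
  have lnN: "ln (real N) = y * (real d * L)" unfolding y_def using d_pos L1 by simp
  have r_ge: "real r \<ge> real D powr (3 / 4 * real e)" unfolding r_def by linarith
  have "real D powr (3 / 4 * real e) > 0" using D by simp
  then have r_pos: "real r > 0" using r_ge by (rule less_le_trans)
  have lnr: "ln (real r) \<ge> 3 / 8 * (real d * L)"
  proof -
    have "ln (real D powr (3 / 4 * real e)) \<le> ln (real r)"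
      using r_ge r_pos D by (subst ln_le_cancel_iff) auto
    then show ?thesis using D d unfolding L_def by (simp add: ln_powr)
  qed
  moreover have "3 / 8 * (real d * L) > 0" using d_pos L1 by simp
  ultimately have lnr_pos: "ln (real r) > 0" by (rule less_le_trans[rotated])
  define n where "n = nat \<lceil>ln (real N) / ln (real r)\<rceil>"
  have "real n \<ge> ln (real N) / ln (real r)" unfolding n_def by linarith
  then have "ln (real N) \<le> real n * ln (real r)" using lnr_pos by (simp add: divide_le_eq)
  also have "\<dots> = ln (real r ^ n)" using r_pos by (simp add: ln_realpow)
  finally have "real N \<le> real r ^ n" using N_pos r_pos by (simp add: ln_le_cancel_iff)
  then have N_le: "N \<le> r ^ n" by (simp flip: of_nat_power)
  have "ln (real N) / ln (real r) \<le> 8 / 3 * y"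
  proof -
    have "ln (real N) / ln (real r) \<le> ln (real N) / (3 / 8 * (real d * L))"
      using lnr lnN y1 d_pos L1 lnr_pos by (intro divide_left_mono) auto
    also have "\<dots> = 8 / 3 * y" unfolding y_def by simp
    finally show ?thesis .
  qed
  moreover have "ln (real N) / ln (real r) \<ge> 0" using lnN lnr_pos y1 d_pos L1 by simp
  ultimately have n_le: "real n \<le> 11 / 3 * y" unfolding n_def using y1 by linarith
  have lnk: "ln (real k) < 12 / 11 * ln L"
  proof -
    have "ln (real k) \<le> ln (clique_const d * L)"
      using k clique_const_ge_8[of d] L1 unfolding L_def by (subst ln_le_cancel_iff) auto
    also have "\<dots> = ln (clique_const d) + ln L"
      using clique_const_ge_8[of d] L1 by (intro ln_mult_pos) auto
    finally show ?thesis using L4 by linarith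
  qed
  have "real k ^ n = exp (real n * ln (real k))"
    using k(1) by (simp add: exp_of_nat_mult)
  also have "real n * ln (real k) \<le> 11 / 3 * y * ln (real k)"
    using n_le k(1) by (intro mult_right_mono) auto
  \<comment> \<open>The factor 11/3 from the levels and 12/11 from \<open>k\<close> multiply to the
    4 of the theorem.\<close>
  also have "\<dots> < 11 / 3 * y * (12 / 11 * ln L)"
    using lnk y1 by (intro mult_strict_left_mono) auto
  also have "\<dots> = 4 * (ln L / (real d * L)) * ln (real N)"
    unfolding lnN using d_pos L1 by simp
  finally have "real k ^ n < exp (4 * (ln L / (real d * L)) * ln (real N))"
    by simp
  then have "real k ^ n < real N powr (4 * (ln L / (real d * L)))"
    using N_pos by (simp add: powr_def)
  then show thesis using that N_le unfolding L_def by blast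
qed

section \<open>The construction\<close>

lemma exists_graph_without_large_homogeneous_sets:
  fixes e m D r k n N :: nat
  assumes card: "CARD('n::finite) = 2 * e" and "e > 0" "D > 0" "2 * m * e \<le> D" "r \<le> m ^ e" "k > 0"
    and small: "2 * (\<Prod>j<k. real r / real (m ^ e) *
      (real (m ^ e) * (1/2) ^ (j div 2) + 2 * (real j)\<^sup>2)) < 1"
    and "N \<le> r ^ n"
  obtains V :: "(real ^ 'n) set" and E where "card V = N" "semialgebraic_graph V E D"
    "\<forall>S\<subseteq>V. clique S E \<or> indep S E \<longrightarrow> card S \<le> (k - 1) ^ n"
proof -
  obtain a :: "nat \<Rightarrow> real ^ 'n" and W where a: "\<And>r. a r \<noteq> 0"
    and W: "card W = m ^ e" "separated D a W"
    and proper: "proper_pair_colouring W (\<lambda>x y. {sign_vector D a (x - y), sign_vector D a (y - x)})"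
    using exists_points_with_proper_sign_vectors[OF card \<open>e > 0\<close> \<open>2 * m * e \<le> D\<close>] by blast
  define c where "c = (\<lambda>x y. {sign_vector D a (x - y), sign_vector D a (y - x)})"
  interpret proper_pair_colouring W c
    unfolding c_def by (rule proper)
  have "r \<le> card W" "2 * (\<Prod>j<k. real r / real (card W) *
      (real (card W) * (1/2) ^ (j div 2) + 2 * (real j)\<^sup>2)) < 1"
    using W(1) \<open>r \<le> m ^ e\<close> small by simp_all
  then obtain F X where X: "X \<subseteq> W" "card X = r"
    and avoid: "\<forall>S\<subseteq>X. card S = k \<longrightarrow>
      \<not> pair_colours c S \<subseteq> F \<and> pair_colours c S \<inter> F \<noteq> {}"
    by (rule exists_subset_without_homogeneous_sets)
  \<comment> \<open>\<open>\<Psi>\<close> sees a sign vector only through the unordered pair with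
    its negative, which is the colour; hence it is invariant under negation.\<close>
  define \<Psi> where "\<Psi> = (\<lambda>\<sigma>. {\<sigma>, map uminus \<sigma>} \<in> F)"
  define R where "R = (\<lambda>x y. \<Psi> (sign_vector D a (x - y)))"
  have R: "R x y \<longleftrightarrow> c x y \<in> F" for x y
    unfolding R_def \<Psi>_def c_def using sign_vector_minus[of D a "x - y"] by simp
  have \<Psi>_sym: "\<Psi> (map uminus \<sigma>) = \<Psi> \<sigma>" for \<sigma>
    unfolding \<Psi>_def by (simp add: comp_def insert_commute)
  have "finite X" using X(1) finite_vertices by (rule finite_subset)
  have X_bound: "card S \<le> k - 1" if S: "S \<subseteq> X" "homogeneous R S" for S
  proof (rule ccontr)
    assume "\<not> ?thesis"
    then have "k \<le> card S" by linarith
    then obtain T where T: "T \<subseteq> S" "card T = k"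
      by (metis obtain_subset_with_card_n)
    have "homogeneous R T" using S(2) T(1) by (rule homogeneous_subset)
    then have "pair_colours c T \<subseteq> F \<or> pair_colours c T \<inter> F = {}"
      unfolding homogeneous_def R pair_colours_def by blast
    moreover have "T \<subseteq> X" using T(1) S(1) by (rule order_trans)
    ultimately show False using avoid T(2) by simp
  qed
  have "\<exists>V. finite V \<and> separated D a V \<and> card V = card X ^ n \<and>
      (\<forall>S\<subseteq>V. homogeneous R S \<longrightarrow> card S \<le> (k - 1) ^ n)"
    unfolding R_def
    by (rule exists_lexicographic_power[OF \<open>finite X\<close> separated_subset[OF W(2) X(1)] \<open>D > 0\<close>])
      (rule X_bound[unfolded R_def])
  then obtain V where V: "finite V" "card V = r ^ n"
    and V_bound: "\<And>S. S \<subseteq> V \<Longrightarrow> homogeneous R S \<Longrightarrow> card S \<le> (k - 1) ^ n"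
    unfolding X(2) by blast
  \<comment> \<open>Passing to an induced subgraph on exactly \<open>N\<close> vertices creates no
    new homogeneous sets.\<close>
  obtain V' where V': "V' \<subseteq> V" "card V' = N"
    using \<open>N \<le> r ^ n\<close> V(2) by (metis obtain_subset_with_card_n)
  have "finite V'" using V'(1) V(1) by (rule finite_subset)
  obtain E where E: "semialgebraic_graph V' E D"
    "\<forall>S\<subseteq>V'. clique S E \<or> indep S E \<longrightarrow> homogeneous R S"
    unfolding R_def
    by (rule exists_graph_of_sign_vectors[where a = a and D = D and \<Psi> = \<Psi>,
          OF \<open>finite V'\<close> a \<Psi>_sym])
  show thesis
  proof (rule that[OF V'(2) E(1)], intro allI impI)
    fix S assume S: "S \<subseteq> V'" "clique S E \<or> indep S E"
    show "card S \<le> (k - 1) ^ n"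
    proof (rule V_bound)
      show "S \<subseteq> V" using S(1) V'(1) by (rule order_trans)
      show "homogeneous R S" using E(2) S by blast
    qed
  qed
qed

theorem proposition6p5:
  fixes d :: nat
  assumes "CARD('n::finite) = d" and "d \<ge> 2" and "even d"
  shows "\<exists>\<epsilon> :: nat \<Rightarrow> real. \<epsilon> \<longlonglongrightarrow> 0 \<and>
    (\<exists>D0 :: nat. \<forall>D \<ge> D0. \<forall>N :: nat. N \<ge> D ^ d \<longrightarrow>
      (\<exists>(V :: (real ^ 'n) set) E.
         card V = N \<and> semialgebraic_graph V E D \<and>
         \<not> (\<exists>S \<subseteq> V. (clique S E \<or> indep S E) \<and>
              real (card S) \<ge>
                real N powr ((4 + \<epsilon> D) * (ln (ln (real D)) / (real d * ln (real D)))))))"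
proof -
  obtain e where e: "d = 2 * e" "e > 0" using assms(2,3) by (auto elim!: evenE)
  then have card: "CARD('n) = 2 * e" using assms(1) by simp
  obtain D0 where D0: "\<And>D. D \<ge> D0 \<Longrightarrow> large_degree d D"
    using eventually_large_degree[of d] unfolding eventually_sequentially by blast
  \<comment> \<open>Written with \<open>4 + 0\<close> to match the statement for the witness
    \<open>\<epsilon> = 0\<close>.\<close>
  have "\<exists>(V :: (real ^ 'n) set) E. card V = N \<and> semialgebraic_graph V E D \<and>
      \<not> (\<exists>S \<subseteq> V. (clique S E \<or> indep S E) \<and>
        real (card S) \<ge> real N powr ((4 + 0) * (ln (ln (real D)) / (real d * ln (real D)))))"
    if DN: "D \<ge> D0" "N \<ge> D ^ d" for D N
  proof -
    let ?r = "nat \<lceil>real D powr (3 / 4 * real e)\<rceil>"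
    note large = D0[OF DN(1)]
    obtain k where k: "k > 0" "real k \<le> clique_const d * ln (real D)" "?r \<le> (D div d) ^ e"
      "2 * (\<Prod>j<k. real ?r / real ((D div d) ^ e) *
        (real ((D div d) ^ e) * (1/2) ^ (j div 2) + 2 * (real j)\<^sup>2)) < 1"
      by (rule small_first_moment[OF large e])
    obtain n where n: "N \<le> ?r ^ n"
      "real k ^ n < real N powr (4 * (ln (ln (real D)) / (real d * ln (real D))))"
      by (rule exists_number_of_levels[OF large e DN(2) k(1,2)])
    have "D > 0" using large unfolding large_degree_def by simp
    \<comment> \<open>With \<open>m = D div d\<close> the construction uses
      \<open>2 * m * e = d * (D div d)\<close> forms, which fit into the available
      \<open>D\<close>.\<close>
    moreover have "2 * (D div d) * e \<le> D"
      using times_div_less_eq_dividend[of d D] e(1) by (simp add: mult_ac)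
    ultimately obtain V :: "(real ^ 'n) set" and E where V: "card V = N" "semialgebraic_graph V E D"
      "\<forall>S\<subseteq>V. clique S E \<or> indep S E \<longrightarrow> card S \<le> (k - 1) ^ n"
      by (rule exists_graph_without_large_homogeneous_sets[OF card e(2) _ _ k(3,1,4) n(1)])
    have "real (card S) < real N powr (4 * (ln (ln (real D)) / (real d * ln (real D))))"
      if "S \<subseteq> V" "clique S E \<or> indep S E" for S
    proof -
      have "card S \<le> (k - 1) ^ n"
        using V(3) that by blast
      also have "\<dots> \<le> k ^ n"
        by (rule power_mono) auto
      finally have "real (card S) \<le> real k ^ n" by (simp flip: of_nat_power)
      then show ?thesis using n(2) by linarith
    qed
    then show ?thesis using V(1,2) by (intro exI[of _ V] exI[of _ E]) (auto simp: not_le)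
  qed
  then show ?thesis
    by (intro exI[of _ "\<lambda>_. 0"] conjI exI[of _ D0] allI impI) auto
qed

end
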